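(* Let $\varepsilon>0$ and let $\rho_{A_1\ldots A_m}$ be a quantum $\varepsilon$-approximate Markov chain on a 1D closed chain $A=A_1\ldots A_m$ (labels taken modulo $m$, $m+1\equiv1$), i.e. $$I(A_i:A\setminus A_{i-1}A_iA_{i+1}\,|\,A_{i-1}A_{i+1})_\rho\le\varepsilon\qquad\forall i\in[1,m].$$ (i) Assume that $\rho_{A_1\ldots A_m}$ also satisfies $$I(A_i:A\setminus A_{i-1}A_iA_{i+1})_\rho\le\varepsilon\qquad\forall i\in[1,m].$$ Then there exists a short-range Hamiltonian (Hermitian operator) $H=\sum_i h_{A_{i-1},A_i,A_{i+1}}$, with $\mathrm{supp}(h_{A_{i-1},A_i,A_{i+1}})=A_{i-1}A_iA_{i+1}$, such that $S\left(\rho\,\|\,e^{-H}/Z\right)\le\varepsilon m$, where $Z=\mathrm{Tr}\,e^{-H}$. (ii) Assume that for any $i\in[1,m]$ the reduced state $\mathrm{Tr}_{A_i}(\rho_{A_1\ldots A_m})$ is a quantum $\varepsilon$-approximate Markov chain for the 1D open chain $A_{i+1}A_{i+2}\ldots A_{i-1}$. Then there exists a short-range Hamiltonian (Hermitian operator) $H=\sum_i h_{A_{i-1},A_i,A_{i+1}}$, with $\mathrm{supp}(h_{A_{i-1},A_i,A_{i+1}})=A_{i-1}A_iA_{i+1}$, such that $S\left(\rho\,\|\,e^{-H}/Z\right)\le\varepsilon m$, where $Z=\mathrm{Tr}\,e^{-H}$.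
   Context: All Hilbert spaces $\mathcal{H}_{A_i}$ are finite-dimensional; $\rho$ is a density matrix on $\mathcal{H}_{A_1}\otimes\cdots\otimes\mathcal{H}_{A_m}$. $\log$ has base 2. $S(X)_\rho=-\mathrm{Tr}(\rho_X\log\rho_X)$ is the von Neumann entropy of the reduced state $\rho_X$; $I(A:C)_\rho=S(A)_\rho+S(C)_\rho-S(AC)_\rho$; $I(A:C|B)_\rho=S(AB)_\rho+S(BC)_\rho-S(ABC)_\rho-S(B)_\rho$ (these are $0$ if $A$ or $C$ is the empty system). The relative entropy is $S(\rho\|\sigma)=\mathrm{Tr}(\rho(\log\rho-\log\sigma))$ if the range of $\rho$ is contained in the range of $\sigma$, and $+\infty$ otherwise. A state $\sigma_{Y_1\ldots Y_k}$ is a quantum $\varepsilon$-approximate Markov chain for the 1D open chain $Y_1Y_2\ldots Y_k$ if $I(Y_1\ldots Y_{j-1}:Y_{j+1}\ldots Y_k|Y_j)_\sigma\le\varepsilon$ for all $j\in[1,k]$. "$\mathrm{supp}(O)=X$" means that $O=O_X\otimes1_{X^c}$ for some operator $O_X$ on $\mathcal{H}_X$, i.e. $O$ acts only on $X$. *)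

theory Defs
  imports
    Complex_Main
    "HOL-Library.Extended_Real"
    "Jordan_Normal_Form.Schur_Decomposition"
begin

section \<open>Finite-dimensional operators\<close>

definition mat_trace :: "complex mat \<Rightarrow> complex" where
  "mat_trace A = (\<Sum>i<dim_row A. A $$ (i, i))"

definition is_hermitian :: "complex mat \<Rightarrow> bool" where
  "is_hermitian A \<longleftrightarrow> square_mat A \<and> mat_adjoint A = A"

definition is_unitary :: "complex mat \<Rightarrow> bool" where
  "is_unitary U \<longleftrightarrow> square_mat U \<and>
     mat_adjoint U * U = 1\<^sub>m (dim_row U) \<and> U * mat_adjoint U = 1\<^sub>m (dim_row U)"

text \<open>The order on \<^typ>\<open>complex\<close> makes \<open>0 \<le> z\<close> mean that \<open>z\<close> is real and nonnegative.\<close>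

definition density_matrix :: "nat \<Rightarrow> complex mat \<Rightarrow> bool" where
  "density_matrix n R \<longleftrightarrow> R \<in> carrier_mat n n \<and> is_hermitian R \<and>
     (\<forall>v \<in> carrier_vec n. 0 \<le> (R *\<^sub>v v) \<bullet>c v) \<and> mat_trace R = 1"

definition mat_range :: "complex mat \<Rightarrow> complex vec set" where
  "mat_range A = {A *\<^sub>v v | v. v \<in> carrier_vec (dim_col A)}"

definition mat_exp :: "complex mat \<Rightarrow> complex mat" where
  "mat_exp A = mat (dim_row A) (dim_row A) (\<lambda>(i, j). \<Sum>k. (A ^\<^sub>m k) $$ (i, j) / fact k)"

definition real_diag_mat :: "nat \<Rightarrow> (nat \<Rightarrow> real) \<Rightarrow> complex mat" where
  "real_diag_mat n e = mat n n (\<lambda>(i, j). if i = j then complex_of_real (e i) else 0)"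

text \<open>
  Functional calculus \<open>f(A) = U diag(f(e\<^sub>0), f(e\<^sub>1), \<dots>) U\<^sup>*\<close> for a Hermitian matrix
  \<open>A = U diag(e\<^sub>0, e\<^sub>1, \<dots>) U\<^sup>*\<close> with \<open>U\<close> unitary and \<open>e\<close> real. The result does not depend on the
  diagonalisation, so the choice operator picks the only possible value.
\<close>

definition herm_fun :: "(real \<Rightarrow> real) \<Rightarrow> complex mat \<Rightarrow> complex mat" where
  "herm_fun f A = (SOME B. \<exists>U e. is_unitary U \<and> dim_row U = dim_row A \<and>
      A = U * real_diag_mat (dim_row A) e * mat_adjoint U \<and>
      B = U * real_diag_mat (dim_row A) (\<lambda>i. f (e i)) * mat_adjoint U)"

text \<open>
  Since \<^term>\<open>log 2 0 = (0::real)\<close>, the logarithm of a positive semidefinite matrix is its logarithm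
  on its range and zero on its kernel. This implements \<open>0 log 0 = 0\<close> in the entropy, and
  in the relative entropy it gives \<open>log \<sigma>\<close> on the range of \<open>\<sigma>\<close>, the only part that is used when
  the range of \<open>\<rho>\<close> is contained in it.
\<close>

definition mat_log2 :: "complex mat \<Rightarrow> complex mat" where
  "mat_log2 = herm_fun (log 2)"

definition von_neumann_entropy :: "complex mat \<Rightarrow> real" where
  "von_neumann_entropy R = - Re (mat_trace (R * mat_log2 R))"

definition relative_entropy :: "complex mat \<Rightarrow> complex mat \<Rightarrow> ereal" where
  "relative_entropy R T =
     (if mat_range R \<subseteq> mat_range T
      then ereal (Re (mat_trace (R * (mat_log2 R - mat_log2 T)))) else \<infinity>)"

section \<open>Composite systems\<close>

text \<open>
  Sites are natural numbers and \<open>d i\<close> is the dimension of the space of site \<open>i\<close>, with a fixed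
  orthonormal basis numbered \<open>0, \<dots>, d i - 1\<close>. An operator on the tensor product over a finite set
  \<open>Y\<close> of sites is a matrix in the product basis: the basis vector with number \<open>x\<^sub>i\<close> at each site
  \<open>i \<in> Y\<close> has the index whose mixed-radix digits are the \<open>x\<^sub>i\<close>, where the place value of site \<open>i\<close> is
  the product of the \<open>d j\<close> over all \<open>j \<in> Y\<close> with \<open>j < i\<close>.
\<close>

definition sys_dim :: "(nat \<Rightarrow> nat) \<Rightarrow> nat set \<Rightarrow> nat" where
  "sys_dim d Y = (\<Prod>i\<in>Y. d i)"

definition place_value :: "(nat \<Rightarrow> nat) \<Rightarrow> nat set \<Rightarrow> nat \<Rightarrow> nat" where
  "place_value d Y i = (\<Prod>j\<in>{j \<in> Y. j < i}. d j)"

definition site_digit :: "(nat \<Rightarrow> nat) \<Rightarrow> nat set \<Rightarrow> nat \<Rightarrow> nat \<Rightarrow> nat" where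
  "site_digit d Y k i = k div place_value d Y i mod d i"

text \<open>
  For \<open>X \<subseteq> Y\<close>, the index for \<open>X\<close> of the restriction to \<open>X\<close> of the basis configuration with index
  \<open>k\<close> for \<open>Y\<close>.
\<close>

definition sub_index :: "(nat \<Rightarrow> nat) \<Rightarrow> nat set \<Rightarrow> nat set \<Rightarrow> nat \<Rightarrow> nat" where
  "sub_index d Y X k = (\<Sum>i\<in>X. site_digit d Y k i * place_value d X i)"

text \<open>
  The partial trace over \<open>Y - X\<close> of an operator on \<open>Y\<close>: the entry \<open>(a, b)\<close> sums the entries
  \<open>(k, l)\<close> such that \<open>k\<close> and \<open>l\<close> restrict to \<open>a\<close> and \<open>b\<close> on \<open>X\<close> and agree on \<open>Y - X\<close>.
\<close>

definition reduced_state :: "(nat \<Rightarrow> nat) \<Rightarrow> nat set \<Rightarrow> nat set \<Rightarrow> complex mat \<Rightarrow> complex mat" where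
  "reduced_state d Y X R = mat (sys_dim d X) (sys_dim d X) (\<lambda>(a, b).
     \<Sum>(k, l) \<in> {(k, l). k < sys_dim d Y \<and> l < sys_dim d Y \<and>
                   sub_index d Y X k = a \<and> sub_index d Y X l = b \<and>
                   sub_index d Y (Y - X) k = sub_index d Y (Y - X) l}. R $$ (k, l))"

text \<open>The operator \<open>P \<otimes> 1\<close> on \<open>Y\<close>, where \<open>P\<close> is an operator on \<open>X \<subseteq> Y\<close> and \<open>1\<close> acts on \<open>Y - X\<close>.\<close>

definition extend_op :: "(nat \<Rightarrow> nat) \<Rightarrow> nat set \<Rightarrow> nat set \<Rightarrow> complex mat \<Rightarrow> complex mat" where
  "extend_op d Y X P = mat (sys_dim d Y) (sys_dim d Y) (\<lambda>(k, l).
     if sub_index d Y (Y - X) k = sub_index d Y (Y - X) l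
     then P $$ (sub_index d Y X k, sub_index d Y X l) else 0)"

definition supported_on :: "(nat \<Rightarrow> nat) \<Rightarrow> nat set \<Rightarrow> nat set \<Rightarrow> complex mat \<Rightarrow> bool" where
  "supported_on d Y X Q \<longleftrightarrow>
     (\<exists>P \<in> carrier_mat (sys_dim d X) (sys_dim d X). Q = extend_op d Y X P)"

section \<open>Entropic quantities of a state \<open>R\<close> on the sites \<open>Y\<close>\<close>

definition entropy :: "(nat \<Rightarrow> nat) \<Rightarrow> nat set \<Rightarrow> complex mat \<Rightarrow> nat set \<Rightarrow> real" where
  "entropy d Y R X = von_neumann_entropy (reduced_state d Y X R)"

text \<open>\<open>I(A : C)\<close>\<close>

definition mutual_info ::
    "(nat \<Rightarrow> nat) \<Rightarrow> nat set \<Rightarrow> complex mat \<Rightarrow> nat set \<Rightarrow> nat set \<Rightarrow> real" where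
  "mutual_info d Y R A C = entropy d Y R A + entropy d Y R C - entropy d Y R (A \<union> C)"

text \<open>\<open>I(A : C | B)\<close>, with the arguments in the order \<open>A\<close>, \<open>C\<close>, \<open>B\<close>\<close>

definition cond_mutual_info ::
    "(nat \<Rightarrow> nat) \<Rightarrow> nat set \<Rightarrow> complex mat \<Rightarrow> nat set \<Rightarrow> nat set \<Rightarrow> nat set \<Rightarrow> real" where
  "cond_mutual_info d Y R A C B =
     entropy d Y R (A \<union> B) + entropy d Y R (B \<union> C) - entropy d Y R (A \<union> B \<union> C) - entropy d Y R B"

section \<open>Approximate Markov chains and short-range Hamiltonians\<close>

definition open_markov_chain ::
    "(nat \<Rightarrow> nat) \<Rightarrow> real \<Rightarrow> nat list \<Rightarrow> complex mat \<Rightarrow> bool" where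
  "open_markov_chain d \<epsilon> ys R \<longleftrightarrow> (\<forall>j < length ys.
     cond_mutual_info d (set ys) R (set (take j ys)) (set (drop (Suc j) ys)) {ys ! j} \<le> \<epsilon>)"

text \<open>The closed chain of \<open>m\<close> sites has the sites \<open>0, \<dots>, m - 1\<close>, site \<open>0\<close> being the neighbour of
  site \<open>m - 1\<close>.\<close>

definition prev_site :: "nat \<Rightarrow> nat \<Rightarrow> nat" where
  "prev_site m i = (i + m - 1) mod m"

definition next_site :: "nat \<Rightarrow> nat \<Rightarrow> nat" where
  "next_site m i = (i + 1) mod m"

definition neighbourhood :: "nat \<Rightarrow> nat \<Rightarrow> nat set" where
  "neighbourhood m i = {prev_site m i, i, next_site m i}"

definition closed_markov_chain :: "(nat \<Rightarrow> nat) \<Rightarrow> nat \<Rightarrow> real \<Rightarrow> complex mat \<Rightarrow> bool" where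
  "closed_markov_chain d m \<epsilon> R \<longleftrightarrow> (\<forall>i < m.
     cond_mutual_info d {..<m} R {i} ({..<m} - neighbourhood m i)
       {prev_site m i, next_site m i} \<le> \<epsilon>)"

definition short_range_hamiltonian :: "(nat \<Rightarrow> nat) \<Rightarrow> nat \<Rightarrow> complex mat \<Rightarrow> bool" where
  "short_range_hamiltonian d m H \<longleftrightarrow> is_hermitian H \<and>
     (\<exists>h. (\<forall>i < m. supported_on d {..<m} (neighbourhood m i) (h i)) \<and>
          H = mat (sys_dim d {..<m}) (sys_dim d {..<m}) (\<lambda>(k, l). \<Sum>i<m. h i $$ (k, l)))"

text \<open>\<open>e\<^sup>-\<^sup>H / Z\<close> with \<open>Z = Tr e\<^sup>-\<^sup>H\<close>\<close>

definition gibbs_state :: "complex mat \<Rightarrow> complex mat" where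
  "gibbs_state H = inverse (mat_trace (mat_exp (- H))) \<cdot>\<^sub>m mat_exp (- H)"

end

theory Submission
  imports Defs "HOL-Real_Asymp.Real_Asymp"
begin

text \<open>
  Cover the chain step by step by sets \<open>N\<close> contained in neighbourhoods, each meeting the part that
  is already covered in \<open>B\<close>, and put \<open>H = - \<Sum> (ln \<rho>\<^sub>N - ln \<rho>\<^sub>B)\<close>. For the Gibbs state
  \<open>\<sigma> = e\<^sup>-\<^sup>H / Z\<close>, strong subadditivity gives \<open>S(\<sigma>) \<le> \<Sum> (S(\<sigma>\<^sub>N) - S(\<sigma>\<^sub>B))\<close>, and
  monotonicity of the relative entropy \<open>S(\<sigma>\<^sub>N \<parallel> \<rho>\<^sub>N)\<close> under the partial trace to \<open>B\<close> turns this into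
  \<open>Z \<le> 1\<close>. Hence \<open>S(\<rho> \<parallel> \<sigma>) \<le> \<Sum> (S(\<rho>\<^sub>N) - S(\<rho>\<^sub>B)) - S(\<rho>)\<close>, which is a sum of conditional mutual
  informations of \<open>\<rho>\<close>. For suitable covers this is at most \<open>(m - 1) \<epsilon>\<close>. The slack \<open>\<epsilon>\<close>
  pays for replacing \<open>\<rho>\<close> in the definition of \<open>H\<close> by \<open>(1 - t) \<rho> + t / D\<close> with a small \<open>t > 0\<close>, whose
  marginals are invertible.

  Monotonicity is obtained from \<open>ln p - ln q = lim (ln (q + T p) - ln (1 + T) - ln q)\<close> as
  \<open>T \<rightarrow> \<infinity>\<close>. The derivative in \<open>T\<close> of the corresponding trace expression is the supremum over \<open>X\<close> of
  \<open>2 Re Tr X\<^sup>*\<rho> - Tr X\<^sup>*\<sigma>X - T Tr X\<rho>X\<^sup>*\<close>, up to a term that depends on \<open>T\<close> only, and the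
  operators \<open>X \<otimes> 1\<close> give the supremum for the reduced states.
\<close>

section \<open>Basis indices of composite systems\<close>

text \<open>Logarithms of overlapping marginals need not commute, so neither \<open>e^-H\<close> nor
  \<open>Z\<close> can be evaluated from them. Testing on the Gibbs state itself avoids this:
  \<open>log Z\<close> is S(\<sigma>) - Tr(\<sigma> H) / ln 2, where the first term is bounded by
  entropies of marginals of \<sigma> and the second is a sum of their cross entropies.

  The two parts differ in how the sites 1, ..., m - 1 are covered. In (i) triples {j, j+1, j+2} meet
  the earlier sites in j only; two new sites cost 2\<epsilon>, one \<epsilon> for the Markov
  condition at j+1 and one for the near independence of j+2 from distant sites. In (ii) pairs of
  adjacent sites cost \<epsilon> per new site. Both reach m - 1 at cost at most (m - 2)\<epsilon>.
  The ring is closed at site 0: its two neighbours are covered already, and the error of adding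
  {m-1, 0, 1} over {m-1, 1} is exactly the closed Markov quantity at 0.

  Monotonicity compares N with B, so the perturbed operators must remain the marginals of a single
  state. Mixing with the maximally mixed state achieves this, because its partial traces are again
  maximally mixed.\<close>

definition config_index :: "(nat \<Rightarrow> nat) \<Rightarrow> nat set \<Rightarrow> (nat \<Rightarrow> nat) \<Rightarrow> nat" where
  "config_index d Y x = (\<Sum>i\<in>Y. x i * place_value d Y i)"

lemma sub_index_eq_config_index: "sub_index d Y X k = config_index d X (site_digit d Y k)"
  by (simp add: sub_index_def config_index_def)

text \<open>A site above all others becomes the leading digit and leaves the lower place values
  alone. Hence the inductions on sets of sites below insert the maximum.\<close>

lemma place_value_insert_max:
  assumes "\<And>j. j \<in> Y \<Longrightarrow> j < b"
  shows "place_value d (insert b Y) b = sys_dim d Y"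
    and "i \<in> Y \<Longrightarrow> place_value d (insert b Y) i = place_value d Y i"
proof -
  have "{j \<in> insert b Y. j < b} = Y" using assms by auto
  then show "place_value d (insert b Y) b = sys_dim d Y"
    by (simp add: place_value_def sys_dim_def)
next
  assume "i \<in> Y"
  then have "{j \<in> insert b Y. j < i} = {j \<in> Y. j < i}" using assms by force
  then show "place_value d (insert b Y) i = place_value d Y i"
    by (simp add: place_value_def)
qed

lemma place_value_dvd_sys_dim:
  assumes "finite Y" "i \<in> Y"
  shows "place_value d Y i * d i dvd sys_dim d Y"
proof -
  have "Y = insert i {j \<in> Y. j < i} \<union> {j \<in> Y. i < j}"
    using assms by auto
  then have "sys_dim d Y = (\<Prod>j\<in>insert i {j \<in> Y. j < i} \<union> {j \<in> Y. i < j}. d j)"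
    unfolding sys_dim_def by simp
  also have "\<dots> = (\<Prod>j\<in>insert i {j \<in> Y. j < i}. d j) * (\<Prod>j\<in>{j \<in> Y. i < j}. d j)"
    using assms by (intro prod.union_disjoint) auto
  also have "(\<Prod>j\<in>insert i {j \<in> Y. j < i}. d j) = place_value d Y i * d i"
    using assms by (simp add: place_value_def mult.commute)
  finally show ?thesis by simp
qed

text \<open>The digit at place value \<open>a\<close> with radix \<open>c\<close> depends only on
  the residue modulo \<open>a * c\<close>, which a multiple of \<open>r\<close> does not
  change.\<close>

lemma div_mod_add_mult_cancel:
  fixes a c r x y :: nat
  assumes "a * c dvd r"
  shows "(x + y * r) div a mod c = x div a mod c"
proof -
  have *: "z div a mod c = z mod (a * c) div a" for z
    by (cases "a = 0") (simp_all add: mod_mult2_eq)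
  have "(x + y * r) mod (a * c) = x mod (a * c)"
    using assms by (auto elim!: dvdE simp: mult.left_commute[of y])
  then show ?thesis by (simp only: *)
qed

text \<open>Range and digits are proved together: the leading digit can be read off only when the
  lower part is known to stay below \<open>sys_dim d Y\<close>.\<close>

lemma config_index_less_and_digit:
  assumes "finite Y" "\<And>i. i \<in> Y \<Longrightarrow> x i < d i"
  shows "config_index d Y x < sys_dim d Y \<and> (\<forall>i\<in>Y. site_digit d Y (config_index d Y x) i = x i)"
  using assms
proof (induction Y rule: finite_linorder_max_induct)
  case empty
  then show ?case by (simp add: config_index_def sys_dim_def)
next
  case (insert b Y)
  let ?k = "config_index d Y x"
  have IH: "?k < sys_dim d Y" "\<And>i. i \<in> Y \<Longrightarrow> site_digit d Y ?k i = x i"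
    using insert by auto
  have b: "b \<notin> Y" "x b < d b" using insert by auto
  have idx: "config_index d (insert b Y) x = ?k + x b * sys_dim d Y"
    using insert(1,2) b by (simp add: config_index_def place_value_insert_max)
  have "?k + x b * sys_dim d Y < (x b + 1) * sys_dim d Y" using IH(1) by simp
  also have "\<dots> \<le> d b * sys_dim d Y" using b(2) by (intro mult_right_mono) auto
  finally have "config_index d (insert b Y) x < sys_dim d (insert b Y)"
    using insert(1) b by (simp add: idx sys_dim_def)
  moreover have "site_digit d (insert b Y) (config_index d (insert b Y) x) i = x i"
    if "i \<in> Y" for i
    unfolding idx site_digit_def
    using that insert(1,2) IH(2)[OF that]
    by (simp add: place_value_insert_max div_mod_add_mult_cancel place_value_dvd_sys_dim
        site_digit_def)
  moreover have "site_digit d (insert b Y) (config_index d (insert b Y) x) b = x b"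
    unfolding idx site_digit_def using insert(2) IH(1) b(2)
    by (simp add: place_value_insert_max)
  ultimately show ?case by auto
qed

text \<open>The leading digit of \<open>k\<close> is \<open>k div sys_dim d Y\<close> and the others
  are those of \<open>k mod sys_dim d Y\<close>, so the induction is division with remainder and
  needs \<open>k\<close> arbitrary.\<close>

lemma config_index_digits:
  assumes "finite Y" "\<And>i. i \<in> Y \<Longrightarrow> 0 < d i" "k < sys_dim d Y"
  shows "config_index d Y (site_digit d Y k) = k"
  using assms
proof (induction Y arbitrary: k rule: finite_linorder_max_induct)
  case empty
  then show ?case by (simp add: config_index_def sys_dim_def)
next
  case (insert b Y)
  let ?D = "sys_dim d Y"
  have b: "b \<notin> Y" using insert by auto
  have D: "sys_dim d (insert b Y) = d b * ?D" using insert(1) b by (simp add: sys_dim_def)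
  have Dpos: "0 < ?D" unfolding sys_dim_def using insert by (intro prod_pos) auto
  have dig: "site_digit d (insert b Y) k i = site_digit d Y (k mod ?D) i" if "i \<in> Y" for i
  proof -
    have "(k mod ?D + k div ?D * ?D) div place_value d Y i mod d i
        = k mod ?D div place_value d Y i mod d i"
      by (rule div_mod_add_mult_cancel) (rule place_value_dvd_sys_dim[OF insert(1) that])
    then have "k div place_value d Y i mod d i = k mod ?D div place_value d Y i mod d i"
      by (simp only: mod_div_mult_eq)
    then show ?thesis using insert(2) that by (simp add: site_digit_def place_value_insert_max)
  qed
  have "k div ?D < d b" using insert.prems(2) Dpos unfolding D
    by (simp add: less_mult_imp_div_less)
  then have digb: "site_digit d (insert b Y) k b = k div ?D"
    using insert(2) by (simp add: site_digit_def place_value_insert_max)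
  have "config_index d (insert b Y) (site_digit d (insert b Y) k)
      = config_index d Y (site_digit d Y (k mod ?D)) + (k div ?D) * ?D"
    using insert(1,2) b by (simp add: config_index_def place_value_insert_max dig digb)
  also have "config_index d Y (site_digit d Y (k mod ?D)) = k mod ?D"
    using insert Dpos by simp
  finally show ?case by (simp only: mod_div_mult_eq)
qed

lemma config_index_cong:
  "(\<And>i. i \<in> Y \<Longrightarrow> x i = y i) \<Longrightarrow> config_index d Y x = config_index d Y y"
  by (simp add: config_index_def)

lemma sys_dim_empty [simp]: "sys_dim d {} = 1"
  by (simp add: sys_dim_def)

section \<open>Splitting a basis index into its parts on \<open>X\<close> and on
  \<open>Y - X\<close>\<close>

locale sites =
  fixes d :: "nat \<Rightarrow> nat" and V :: "nat set"
  assumes finite_V: "finite V" and dim_pos: "i \<in> V \<Longrightarrow> 0 < d i"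
begin

lemma finite_sub [simp]: "Y \<subseteq> V \<Longrightarrow> finite Y"
  using finite_V finite_subset by blast

lemma sys_dim_pos: "Y \<subseteq> V \<Longrightarrow> 0 < sys_dim d Y"
  unfolding sys_dim_def using dim_pos by (intro prod_pos) auto

lemma site_digit_less: "i \<in> V \<Longrightarrow> site_digit d Y k i < d i"
  by (simp add: site_digit_def dim_pos)

lemma sub_index_less: "X \<subseteq> V \<Longrightarrow> sub_index d Y X k < sys_dim d X"
  unfolding sub_index_eq_config_index
  by (intro config_index_less_and_digit[THEN conjunct1]) (auto intro: site_digit_less)

lemma site_digit_config_index:
  assumes "X \<subseteq> V" "\<And>i. i \<in> X \<Longrightarrow> x i < d i" "i \<in> X"
  shows "site_digit d X (config_index d X x) i = x i"
  using config_index_less_and_digit[of X x d] assms by auto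

lemma site_digit_sub_index:
  assumes "X \<subseteq> V" "i \<in> X"
  shows "site_digit d X (sub_index d Y X k) i = site_digit d Y k i"
  unfolding sub_index_eq_config_index
  by (rule site_digit_config_index) (use assms in \<open>auto intro: site_digit_less\<close>)

lemma index_eqI:
  assumes "Y \<subseteq> V" "k < sys_dim d Y" "l < sys_dim d Y"
    "\<And>i. i \<in> Y \<Longrightarrow> site_digit d Y k i = site_digit d Y l i"
  shows "k = l"
proof -
  have "k = config_index d Y (site_digit d Y k)"
    using assms dim_pos by (subst config_index_digits) auto
  also have "\<dots> = config_index d Y (site_digit d Y l)"
    by (rule config_index_cong) (use assms in auto)
  also have "\<dots> = l" using assms dim_pos by (subst config_index_digits) auto
  finally show ?thesis .
qed

lemma sub_index_eq_iff:
  assumes "X \<subseteq> V"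
  shows "sub_index d Y X k = sub_index d Z X l \<longleftrightarrow>
    (\<forall>i\<in>X. site_digit d Y k i = site_digit d Z l i)"
proof
  assume "sub_index d Y X k = sub_index d Z X l"
  then show "\<forall>i\<in>X. site_digit d Y k i = site_digit d Z l i"
    using site_digit_sub_index[OF assms] by metis
qed (auto simp: sub_index_eq_config_index intro: config_index_cong)

lemma sub_index_trans:
  assumes "X \<subseteq> V" "Z \<subseteq> X"
  shows "sub_index d X Z (sub_index d Y X k) = sub_index d Y Z k"
  using assms by (subst sub_index_eq_iff) (auto simp: site_digit_sub_index)

text \<open>For \<open>X \<subseteq> Y\<close> this is the index of the product vector
  \<open>e_a \<otimes> e_c\<close> with \<open>e_a\<close> on \<open>X\<close> and
  \<open>e_c\<close> on \<open>Y - X\<close>, the inverse of taking the two \<open>sub_index\<close>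
  values.\<close>

definition glue :: "nat set \<Rightarrow> nat set \<Rightarrow> nat \<Rightarrow> nat \<Rightarrow> nat" where
  "glue Y X a c = config_index d Y (\<lambda>i. if i \<in> X then site_digit d X a i else site_digit d (Y - X) c i)"

lemma glue_less: "Y \<subseteq> V \<Longrightarrow> glue Y X a c < sys_dim d Y"
  unfolding glue_def
  by (intro config_index_less_and_digit[THEN conjunct1]) (auto intro: site_digit_less)

lemma site_digit_glue:
  assumes "Y \<subseteq> V" "i \<in> Y"
  shows "site_digit d Y (glue Y X a c) i
    = (if i \<in> X then site_digit d X a i else site_digit d (Y - X) c i)"
  unfolding glue_def
  by (rule site_digit_config_index) (use assms in \<open>auto intro: site_digit_less\<close>)

lemma sub_index_glue:
  assumes "Y \<subseteq> V" "X \<subseteq> Y"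
  shows "a < sys_dim d X \<Longrightarrow> sub_index d Y X (glue Y X a c) = a"
    and "c < sys_dim d (Y - X) \<Longrightarrow> sub_index d Y (Y - X) (glue Y X a c) = c"
proof -
  assume a: "a < sys_dim d X"
  have X: "X \<subseteq> V" using assms by auto
  show "sub_index d Y X (glue Y X a c) = a"
  proof (rule index_eqI[OF X sub_index_less[OF X] a])
    fix i assume "i \<in> X"
    moreover have "i \<in> Y" using \<open>i \<in> X\<close> assms by auto
    ultimately show "site_digit d X (sub_index d Y X (glue Y X a c)) i = site_digit d X a i"
      using X assms(1) by (simp add: site_digit_sub_index site_digit_glue)
  qed
next
  assume c: "c < sys_dim d (Y - X)"
  have Z: "Y - X \<subseteq> V" using assms by auto
  show "sub_index d Y (Y - X) (glue Y X a c) = c"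
  proof (rule index_eqI[OF Z sub_index_less[OF Z] c])
    fix i assume "i \<in> Y - X"
    then show "site_digit d (Y - X) (sub_index d Y (Y - X) (glue Y X a c)) i
        = site_digit d (Y - X) c i"
      using Z assms(1) by (simp add: site_digit_sub_index site_digit_glue)
  qed
qed

lemma glue_sub_index:
  assumes "Y \<subseteq> V" "X \<subseteq> Y" "k < sys_dim d Y"
  shows "glue Y X (sub_index d Y X k) (sub_index d Y (Y - X) k) = k"
proof (rule index_eqI[of Y])
  have "X \<subseteq> V" "Y - X \<subseteq> V" using assms by auto
  then show "site_digit d Y (glue Y X (sub_index d Y X k) (sub_index d Y (Y - X) k)) i
      = site_digit d Y k i" if "i \<in> Y" for i
    using assms that by (simp add: site_digit_glue site_digit_sub_index)
qed (use assms in \<open>auto intro: glue_less\<close>)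

text \<open>The form in which the tensor factorisation of the space of \<open>Y\<close> into those
  of \<open>X\<close> and \<open>Y - X\<close> enters the computations with entries.\<close>

lemma sum_index_split:
  fixes f :: "nat \<Rightarrow> 'b::comm_monoid_add"
  assumes "Y \<subseteq> V" "X \<subseteq> Y"
  shows "(\<Sum>k<sys_dim d Y. f k) = (\<Sum>a<sys_dim d X. \<Sum>c<sys_dim d (Y - X). f (glue Y X a c))"
proof -
  have XV: "X \<subseteq> V" "Y - X \<subseteq> V" using assms by auto
  have "(\<Sum>a<sys_dim d X. \<Sum>c<sys_dim d (Y - X). f (glue Y X a c))
      = (\<Sum>(a, c)\<in>{..<sys_dim d X} \<times> {..<sys_dim d (Y - X)}. f (glue Y X a c))"
    by (simp add: sum.cartesian_product)
  also have "\<dots> = (\<Sum>k<sys_dim d Y. f k)"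
    by (rule sum.reindex_bij_witness[where i = "\<lambda>k. (sub_index d Y X k, sub_index d Y (Y - X) k)"
          and j = "\<lambda>(a, c). glue Y X a c"])
      (use assms XV in \<open>auto simp: sub_index_glue glue_sub_index intro: sub_index_less glue_less\<close>)
  finally show ?thesis by simp
qed

text \<open>A pair in the defining sum is determined by its common index \<open>c\<close> on
  \<open>Y - X\<close>, which leaves the usual single sum over the environment.\<close>

lemma reduced_state_index:
  assumes Y: "Y \<subseteq> V" and X: "X \<subseteq> Y" and a: "a < sys_dim d X" and b: "b < sys_dim d X"
  shows "reduced_state d Y X R $$ (a, b)
    = (\<Sum>c<sys_dim d (Y - X). R $$ (glue Y X a c, glue Y X b c))"
proof -
  have V: "X \<subseteq> V" "Y - X \<subseteq> V" using assms by auto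
  let ?S = "{(k, l). k < sys_dim d Y \<and> l < sys_dim d Y \<and>
                   sub_index d Y X k = a \<and> sub_index d Y X l = b \<and>
                   sub_index d Y (Y - X) k = sub_index d Y (Y - X) l}"
  have "reduced_state d Y X R $$ (a, b) = (\<Sum>(k, l)\<in>?S. R $$ (k, l))"
    using a b by (simp add: reduced_state_def)
  also have "\<dots> = (\<Sum>c<sys_dim d (Y - X). R $$ (glue Y X a c, glue Y X b c))"
  proof (rule sum.reindex_bij_witness[where j = "\<lambda>(k, l). sub_index d Y (Y - X) k"
          and i = "\<lambda>c. (glue Y X a c, glue Y X b c)"], goal_cases)
    case (1 x)
    then show ?case using glue_sub_index[OF Y X, of "fst x"] glue_sub_index[OF Y X, of "snd x"]
      by auto
  next
    case (5 x)
    then show ?case using glue_sub_index[OF Y X, of "fst x"] glue_sub_index[OF Y X, of "snd x"]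
      by auto
  qed (use Y X a b V in \<open>auto simp: sub_index_glue intro: sub_index_less glue_less\<close>)
  finally show ?thesis .
qed

end

section \<open>Adjoints and traces\<close>

lemma mat_adjoint_carrier [simp]: "A \<in> carrier_mat n m \<Longrightarrow> mat_adjoint A \<in> carrier_mat m n"
  by (auto simp: mat_adjoint_def)

lemma mat_adjoint_dim [simp]:
  "dim_row (mat_adjoint A) = dim_col A" "dim_col (mat_adjoint A) = dim_row A"
  by (auto simp: mat_adjoint_def)

lemma mat_adjoint_index [simp]:
  fixes A :: "complex mat"
  shows "i < dim_col A \<Longrightarrow> j < dim_row A \<Longrightarrow> mat_adjoint A $$ (i, j) = cnj (A $$ (j, i))"
  by (simp add: mat_adjoint_def mat_of_rows_def)

lemma mult_mat_index:
  "A \<in> carrier_mat n k \<Longrightarrow> B \<in> carrier_mat k m \<Longrightarrow> i < n \<Longrightarrow> j < m \<Longrightarrow>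
    (A * B) $$ (i, j) = (\<Sum>l<k. A $$ (i, l) * B $$ (l, j))"
  by (auto simp: scalar_prod_def lessThan_atLeast0)

lemma square_mult_carrier [simp]:
  "A \<in> carrier_mat n n \<Longrightarrow> B \<in> carrier_mat n n \<Longrightarrow> A * B \<in> carrier_mat n n"
  by (rule mult_carrier_mat)

lemma mat_adjoint_mult:
  fixes A B :: "complex mat"
  assumes "A \<in> carrier_mat n k" "B \<in> carrier_mat k m"
  shows "mat_adjoint (A * B) = mat_adjoint B * mat_adjoint A"
proof (rule eq_matI)
  fix i j assume "i < dim_row (mat_adjoint B * mat_adjoint A)"
    "j < dim_col (mat_adjoint B * mat_adjoint A)"
  then have ij: "i < m" "j < n" using assms by auto
  have "mat_adjoint (A * B) $$ (i, j) = (\<Sum>l<k. cnj (A $$ (j, l)) * cnj (B $$ (l, i)))"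
    using assms ij by (simp add: mult_mat_index[OF assms] del: index_mult_mat(1))
  also have "\<dots> = (\<Sum>l<k. mat_adjoint B $$ (i, l) * mat_adjoint A $$ (l, j))"
    using assms ij by (intro sum.cong) auto
  also have "\<dots> = (mat_adjoint B * mat_adjoint A) $$ (i, j)"
    using assms ij by (subst mult_mat_index[of _ m k _ n]) auto
  finally show "mat_adjoint (A * B) $$ (i, j) = (mat_adjoint B * mat_adjoint A) $$ (i, j)" .
qed (use assms in auto)

lemma mat_adjoint_adjoint [simp]: "mat_adjoint (mat_adjoint A) = (A :: complex mat)"
  by (rule eq_matI) auto

lemma real_diag_mat_carrier [simp]: "real_diag_mat n e \<in> carrier_mat n n"
  and real_diag_mat_dim [simp]: "dim_row (real_diag_mat n e) = n" "dim_col (real_diag_mat n e) = n"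
  by (auto simp: real_diag_mat_def)

lemma mat_adjoint_real_diag [simp]: "mat_adjoint (real_diag_mat n e) = real_diag_mat n e"
  by (rule eq_matI) (auto simp: real_diag_mat_def)

lemma mult_real_diag_index:
  assumes "A \<in> carrier_mat m n" "i < m" "j < n"
  shows "(A * real_diag_mat n e) $$ (i, j) = A $$ (i, j) * complex_of_real (e j)"
proof -
  have "(A * real_diag_mat n e) $$ (i, j)
      = (\<Sum>l<n. A $$ (i, l) * (if l = j then complex_of_real (e l) else 0))"
    using assms by (subst mult_mat_index[of _ m n _ n]) (auto simp: real_diag_mat_def)
  also have "\<dots> = (\<Sum>l<n. if l = j then A $$ (i, l) * complex_of_real (e l) else 0)"
    by (intro sum.cong) auto
  finally show ?thesis using assms by (simp add: sum.delta)
qed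

lemma real_diag_mult_index:
  assumes "A \<in> carrier_mat n m" "i < n" "j < m"
  shows "(real_diag_mat n e * A) $$ (i, j) = complex_of_real (e i) * A $$ (i, j)"
proof -
  have "(real_diag_mat n e * A) $$ (i, j)
      = (\<Sum>l<n. (if l = i then complex_of_real (e i) else 0) * A $$ (l, j))"
    using assms by (subst mult_mat_index[of _ n n _ m]) (auto simp: real_diag_mat_def intro!: sum.cong)
  also have "\<dots> = (\<Sum>l<n. if l = i then complex_of_real (e i) * A $$ (l, j) else 0)"
    by (intro sum.cong) auto
  finally show ?thesis using assms by (simp add: sum.delta)
qed

lemma mat_trace_carrier: "A \<in> carrier_mat n m \<Longrightarrow> mat_trace A = (\<Sum>i<n. A $$ (i, i))"
  by (auto simp: mat_trace_def)

lemma mat_trace_mult: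
  assumes "A \<in> carrier_mat n m" "B \<in> carrier_mat m n"
  shows "mat_trace (A * B) = (\<Sum>i<n. \<Sum>j<m. A $$ (i, j) * B $$ (j, i))"
proof -
  have "A * B \<in> carrier_mat n n" using assms by simp
  then show ?thesis
    by (simp add: mat_trace_carrier mult_mat_index[OF assms] del: index_mult_mat(1))
qed

lemma mat_trace_mult_comm:
  assumes "A \<in> carrier_mat n m" "B \<in> carrier_mat m n"
  shows "mat_trace (A * B) = mat_trace (B * A)"
  unfolding mat_trace_mult[OF assms] mat_trace_mult[OF assms(2,1)]
  by (subst sum.swap) (simp add: mult.commute)

lemma mat_trace_add:
  "A \<in> carrier_mat n n \<Longrightarrow> B \<in> carrier_mat n n \<Longrightarrow> mat_trace (A + B) = mat_trace A + mat_trace B"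
  by (auto simp: mat_trace_def sum.distrib)

lemma mat_trace_minus:
  "A \<in> carrier_mat n n \<Longrightarrow> B \<in> carrier_mat n n \<Longrightarrow> mat_trace (A - B) = mat_trace A - mat_trace B"
  by (auto simp: mat_trace_def sum_subtractf)

lemma mat_trace_smult: "A \<in> carrier_mat n n \<Longrightarrow> mat_trace (c \<cdot>\<^sub>m A) = c * mat_trace A"
  by (auto simp: mat_trace_def sum_distrib_left)

lemma mat_trace_mult_add:
  assumes "R \<in> carrier_mat n n" "A \<in> carrier_mat n n" "B \<in> carrier_mat n n"
  shows "mat_trace (R * (A + B)) = mat_trace (R * A) + mat_trace (R * B)"
  using assms by (simp add: mult_add_distrib_mat[of _ n n] mat_trace_add[of _ n])

section \<open>Diagonalisation\<close>

definition unitary_mat :: "nat \<Rightarrow> complex mat \<Rightarrow> bool" where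
  "unitary_mat n U \<longleftrightarrow> U \<in> carrier_mat n n \<and> mat_adjoint U * U = 1\<^sub>m n \<and> U * mat_adjoint U = 1\<^sub>m n"

definition diagonalises :: "nat \<Rightarrow> complex mat \<Rightarrow> (nat \<Rightarrow> real) \<Rightarrow> complex mat \<Rightarrow> bool" where
  "diagonalises n U e A \<longleftrightarrow> unitary_mat n U \<and> A = U * real_diag_mat n e * mat_adjoint U"

lemma unitary_matD:
  assumes "unitary_mat n U"
  shows "U \<in> carrier_mat n n" "mat_adjoint U \<in> carrier_mat n n" "dim_row U = n" "dim_col U = n"
    "mat_adjoint U * U = 1\<^sub>m n" "U * mat_adjoint U = 1\<^sub>m n"
  using assms by (auto simp: unitary_mat_def)

lemma unitary_mat_iff: "unitary_mat n U \<longleftrightarrow> is_unitary U \<and> dim_row U = n"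
  by (auto simp: unitary_mat_def is_unitary_def)

lemma unitary_matI:
  assumes "U \<in> carrier_mat n n" "mat_adjoint U * U = 1\<^sub>m n"
  shows "unitary_mat n U"
  using assms mat_mult_left_right_inverse[of "mat_adjoint U" n U] by (simp add: unitary_mat_def)

lemma unitary_mat_mult:
  assumes U: "unitary_mat n U" and V: "unitary_mat n V"
  shows "unitary_mat n (U * V)"
proof (rule unitary_matI)
  note u = unitary_matD[OF U] and v = unitary_matD[OF V]
  show "U * V \<in> carrier_mat n n" using u v by simp
  have "mat_adjoint (U * V) * (U * V) = mat_adjoint V * (mat_adjoint U * (U * V))"
    using u v by (simp add: mat_adjoint_mult[of _ n n _ n] assoc_mult_mat[of _ n n _ n _ n])
  also have "mat_adjoint U * (U * V) = V"
    by (subst assoc_mult_mat[symmetric, of _ n n _ n _ n]) (use u v in auto)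
  finally show "mat_adjoint (U * V) * (U * V) = 1\<^sub>m n" using v by simp
qed

lemma unitary_mat_adjoint: "unitary_mat n U \<Longrightarrow> unitary_mat n (mat_adjoint U)"
  by (simp add: unitary_mat_def)

lemma unitary_sum:
  assumes "unitary_mat n U" "i < n" "j < n"
  shows "(\<Sum>k<n. cnj (U $$ (k, i)) * U $$ (k, j)) = (if i = j then 1 else 0)"
    and "(\<Sum>k<n. U $$ (i, k) * cnj (U $$ (j, k))) = (if i = j then 1 else 0)"
proof -
  note u = unitary_matD[OF assms(1)]
  have "(mat_adjoint U * U) $$ (i, j) = (\<Sum>k<n. cnj (U $$ (k, i)) * U $$ (k, j))"
    using u assms(2,3) by (subst mult_mat_index[of _ n n _ n]) auto
  then show "(\<Sum>k<n. cnj (U $$ (k, i)) * U $$ (k, j)) = (if i = j then 1 else 0)"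
    using u(5) assms by simp
  have "(U * mat_adjoint U) $$ (i, j) = (\<Sum>k<n. U $$ (i, k) * cnj (U $$ (j, k)))"
    using u assms(2,3) by (subst mult_mat_index[of _ n n _ n]) auto
  then show "(\<Sum>k<n. U $$ (i, k) * cnj (U $$ (j, k))) = (if i = j then 1 else 0)"
    using u(6) assms by simp
qed

lemma unitary_matI_sum:
  assumes U: "U \<in> carrier_mat n n"
    and "\<And>i j. i < n \<Longrightarrow> j < n \<Longrightarrow>
      (\<Sum>k<n. cnj (U $$ (k, i)) * U $$ (k, j)) = (if i = j then 1 else 0)"
  shows "unitary_mat n U"
proof (rule unitary_matI[OF U], rule eq_matI)
  fix i j assume "i < dim_row (1\<^sub>m n :: complex mat)" "j < dim_col (1\<^sub>m n :: complex mat)"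
  then have ij: "i < n" "j < n" by auto
  then have "(mat_adjoint U * U) $$ (i, j) = (\<Sum>k<n. cnj (U $$ (k, i)) * U $$ (k, j))"
    using U by (subst mult_mat_index[of _ n n _ n]) auto
  then show "(mat_adjoint U * U) $$ (i, j) = (1\<^sub>m n :: complex mat) $$ (i, j)"
    using assms(2) ij by simp
qed (use U in auto)

lemma conj_diag_index:
  assumes "U \<in> carrier_mat n n" "i < n" "j < n"
  shows "(U * real_diag_mat n e * mat_adjoint U) $$ (i, j)
    = (\<Sum>k<n. complex_of_real (e k) * (U $$ (i, k) * cnj (U $$ (j, k))))"
  using assms
  by (subst mult_mat_index[of _ n n _ n])
    (auto simp: mult_real_diag_index[of _ n] simp del: index_mult_mat(1) intro!: sum.cong)

lemma conj_diag_carrier [simp]: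
  "U \<in> carrier_mat n n \<Longrightarrow> U * real_diag_mat n e * mat_adjoint U \<in> carrier_mat n n"
  by (meson mat_adjoint_carrier mult_carrier_mat real_diag_mat_carrier)

lemma diagonalisesD:
  assumes "diagonalises n U e A"
  shows "unitary_mat n U" "U \<in> carrier_mat n n" "A \<in> carrier_mat n n"
    "i < n \<Longrightarrow> j < n \<Longrightarrow>
      A $$ (i, j) = (\<Sum>k<n. complex_of_real (e k) * (U $$ (i, k) * cnj (U $$ (j, k))))"
  using assms conj_diag_index[of U n i j e] by (auto simp: diagonalises_def unitary_matD)

lemma diagonalisesI:
  assumes "unitary_mat n U" "A \<in> carrier_mat n n"
    "\<And>i j. i < n \<Longrightarrow> j < n \<Longrightarrow>
      A $$ (i, j) = (\<Sum>k<n. complex_of_real (e k) * (U $$ (i, k) * cnj (U $$ (j, k))))"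
  shows "diagonalises n U e A"
  unfolding diagonalises_def
proof
  note u = unitary_matD[OF assms(1)]
  show "A = U * real_diag_mat n e * mat_adjoint U"
    by (rule eq_matI) (use assms u in \<open>auto simp: conj_diag_index[OF u(1)] simp del: index_mult_mat(1)\<close>)
qed fact

lemma unitary_conj_cancel:
  assumes "unitary_mat n U" "A \<in> carrier_mat n n"
  shows "U * (mat_adjoint U * A * U) * mat_adjoint U = A"
proof -
  note u = unitary_matD[OF assms(1)]
  have "U * (mat_adjoint U * A * U) * mat_adjoint U = (U * mat_adjoint U) * (A * (U * mat_adjoint U))"
    using u(1,2) assms(2) by (simp add: assoc_mult_mat[of _ n n _ n _ n])
  also have "\<dots> = A" unfolding u using assms(2) by simp
  finally show ?thesis .
qed

text \<open>The deflation step of the spectral theorem. The characteristic polynomial splits over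
  the complex numbers, so an eigenvector exists; completed to an orthonormal basis it becomes the
  first column of \<open>W\<close>.\<close>

lemma hermitian_unitary_eigencolumn:
  fixes A :: "complex mat"
  assumes A: "A \<in> carrier_mat n n" and n: "n \<noteq> 0"
  obtains W e where "unitary_mat n W"
    "\<And>i. i < n \<Longrightarrow> (mat_adjoint W * A * W) $$ (i, 0) = (if i = 0 then e else 0)"
proof -
  obtain as where as: "char_poly A = (\<Prod>a\<leftarrow>as. [:- a, 1:])" "length as = n"
    using char_poly_factorized[OF A] by blast
  then obtain e es where "as = e # es" using n by (cases as) auto
  then have "poly (char_poly A) e = 0" by (simp add: as)
  then have "eigenvalue A e" by (simp add: eigenvalue_root_char_poly[OF A])
  then obtain v where "eigenvector A v e" unfolding eigenvalue_def by auto
  then have v: "v \<in> carrier_vec n" "v \<noteq> 0\<^sub>v n" "A *\<^sub>v v = e \<cdot>\<^sub>v v"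
    using A by (auto simp: eigenvector_def)
  interpret cof_vec_space n "TYPE(complex)" .
  define b where "b = basis_completion v"
  define ws where "ws = gram_schmidt n b"
  note bc = basis_completion[OF v(1,2), folded b_def]
  then obtain vs where bv: "b = v # vs" using n by (cases b) auto
  have ws: "set ws \<subseteq> carrier_vec n" "corthogonal ws" "length ws = n"
    using gram_schmidt_result[OF bc(2,4,5) refl, folded ws_def] bc(6) by auto
  \<comment> \<open>Gram-Schmidt leaves the first vector unchanged, so column 0 of \<open>W\<close>
    is still an eigenvector after scaling.\<close>
  have "hd ws = v" using gram_schmidt_hd[OF v(1), of vs, folded bv] unfolding ws_def .
  then have ws0: "ws ! 0 = v" using ws n by (cases ws) auto
  have wsc: "ws ! j \<in> carrier_vec n" if "j < n" for j using ws that by auto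
  \<comment> \<open>Gram-Schmidt returns orthogonal vectors only; \<open>c j\<close> are the norms
    by which the columns of \<open>W\<close> are scaled.\<close>
  define c where "c j = sqrt (\<Sum>k<n. (cmod (ws ! j $ k))\<^sup>2)" for j
  have sp: "ws ! i \<bullet>c ws ! j = (\<Sum>k<n. ws ! i $ k * cnj (ws ! j $ k))" if "i < n" "j < n" for i j
    using wsc[OF that(1)] wsc[OF that(2)] by (simp add: scalar_prod_def lessThan_atLeast0)
  have orth: "(\<Sum>k<n. ws ! i $ k * cnj (ws ! j $ k)) = 0 \<longleftrightarrow> i \<noteq> j" if "i < n" "j < n" for i j
    using corthogonalD[OF ws(2), of i j] that ws(3) sp[OF that] by auto
  have self: "(\<Sum>k<n. ws ! j $ k * cnj (ws ! j $ k)) = of_real ((c j)\<^sup>2)" for j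
    by (simp add: c_def sum_nonneg complex_norm_square[symmetric])
  have cpos: "c j \<noteq> 0" if "j < n" for j
    using orth[OF that that] unfolding self by auto
  define W where "W = mat n n (\<lambda>(k, j). ws ! j $ k / of_real (c j))"
  have W: "W \<in> carrier_mat n n" by (simp add: W_def)
  have uW: "unitary_mat n W"
  proof (rule unitary_matI_sum[OF W])
    fix i j assume ij: "i < n" "j < n"
    have "(\<Sum>k<n. cnj (W $$ (k, i)) * W $$ (k, j))
        = (\<Sum>k<n. ws ! j $ k * cnj (ws ! i $ k)) / (of_real (c i) * of_real (c j))"
      using ij by (simp add: W_def sum_divide_distrib mult.commute)
    also have "\<dots> = (if i = j then 1 else 0)"
      using orth[OF ij(2,1)] self[of i] cpos[OF ij(1)] by (auto simp: power2_eq_square)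
    finally show "(\<Sum>k<n. cnj (W $$ (k, i)) * W $$ (k, j)) = (if i = j then 1 else 0)" .
  qed
  note w = unitary_matD[OF uW]
  have Av: "(\<Sum>k<n. A $$ (l, k) * v $ k) = e * v $ l" if "l < n" for l
    using arg_cong[OF v(3), of "\<lambda>x. x $ l"] that A v(1)
    by (simp add: scalar_prod_def lessThan_atLeast0)
  have AW: "(A * W) $$ (l, 0) = e * W $$ (l, 0)" if "l < n" for l
    using that n A W Av[OF that] ws0
    by (subst mult_mat_index[of _ n n _ n]) (simp_all add: W_def sum_divide_distrib[symmetric])
  have "(mat_adjoint W * A * W) $$ (i, 0) = (if i = 0 then e else 0)" if "i < n" for i
  proof -
    have "mat_adjoint W * A * W = mat_adjoint W * (A * W)"
      using A w by (simp add: assoc_mult_mat[of _ n n _ n _ n])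
    also have "\<dots> $$ (i, 0) = (\<Sum>l<n. cnj (W $$ (l, i)) * (e * W $$ (l, 0)))"
      using A w that n by (subst mult_mat_index[of _ n n _ n]) (auto simp: AW simp del: index_mult_mat(1))
    also have "\<dots> = e * (\<Sum>l<n. cnj (W $$ (l, i)) * W $$ (l, 0))"
      by (simp add: sum_distrib_left mult.left_commute)
    also have "\<dots> = (if i = 0 then e else 0)"
      using unitary_sum(1)[OF uW that, of 0] n by auto
    finally show ?thesis .
  qed
  then show thesis using that uW by blast
qed

lemma is_hermitian_iff:
  assumes "A \<in> carrier_mat n n"
  shows "is_hermitian A \<longleftrightarrow> (\<forall>i<n. \<forall>j<n. A $$ (i, j) = cnj (A $$ (j, i)))"
proof
  assume "is_hermitian A"
  then have "mat_adjoint A = A" by (simp add: is_hermitian_def)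
  then show "\<forall>i<n. \<forall>j<n. A $$ (i, j) = cnj (A $$ (j, i))"
    using assms mat_adjoint_index[of _ A] by (metis carrier_matD)
next
  assume *: "\<forall>i<n. \<forall>j<n. A $$ (i, j) = cnj (A $$ (j, i))"
  have "mat_adjoint A = A"
  proof (rule eq_matI)
    fix i j assume "i < dim_row A" "j < dim_col A"
    then have ij: "i < n" "j < n" using assms by auto
    then have "mat_adjoint A $$ (i, j) = cnj (A $$ (j, i))" using assms by simp
    also have "\<dots> = A $$ (i, j)" using * ij by metis
    finally show "mat_adjoint A $$ (i, j) = A $$ (i, j)" .
  qed (use assms in auto)
  then show "is_hermitian A" using assms by (auto simp: is_hermitian_def)
qed

lemma diagonalises_imp_hermitian:
  assumes "diagonalises n U e A"
  shows "is_hermitian A"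
  using diagonalisesD[OF assms]
  by (subst is_hermitian_iff[of _ n]) (auto simp: mult.commute)

lemma is_hermitian_conj:
  assumes "A \<in> carrier_mat n n" "is_hermitian A" "W \<in> carrier_mat n n"
  shows "is_hermitian (mat_adjoint W * A * W)"
  using assms
  by (simp add: is_hermitian_def mat_adjoint_mult[of _ n n _ n] assoc_mult_mat[of _ n n _ n _ n]
      square_mat.simps)

text \<open>Induction by deflation: after conjugation with \<open>W\<close> the first column is
  supported at entry 0, Hermitian symmetry gives the same for the first row and makes
  \<open>e\<close> real, and the remaining block is Hermitian of size \<open>n\<close>.\<close>

theorem hermitian_diagonalises:
  assumes "A \<in> carrier_mat n n" "is_hermitian A"
  shows "\<exists>U e. diagonalises n U e A"
  using assms
proof (induction n arbitrary: A)
  case 0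
  have "diagonalises 0 (1\<^sub>m 0) e A" for e
    using 0 by (intro diagonalisesI) (auto simp: unitary_mat_def)
  then show ?case by blast
next
  case (Suc n)
  let ?m = "Suc n"
  obtain W e where W: "unitary_mat ?m W"
    and col0: "\<And>i. i < ?m \<Longrightarrow> (mat_adjoint W * A * W) $$ (i, 0) = (if i = 0 then e else 0)"
    using hermitian_unitary_eigencolumn[OF Suc.prems(1)] by blast
  note w = unitary_matD[OF W]
  define B where "B = mat_adjoint W * A * W"
  have B: "B \<in> carrier_mat ?m ?m" using w Suc.prems by (simp add: B_def)
  have hB: "is_hermitian B" unfolding B_def by (rule is_hermitian_conj) (use w Suc.prems in auto)
  have Bsym: "B $$ (i, j) = cnj (B $$ (j, i))" if "i < ?m" "j < ?m" for i j
    using hB that unfolding is_hermitian_iff[OF B] by blast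
  have B0: "B $$ (i, 0) = (if i = 0 then e else 0)" "B $$ (0, i) = (if i = 0 then e else 0)"
    if "i < ?m" for i
  proof -
    show 1: "B $$ (i, 0) = (if i = 0 then e else 0)" using col0[OF that] by (simp add: B_def)
    show "B $$ (0, i) = (if i = 0 then e else 0)"
      using Bsym[of 0 i] 1 that by (cases "i = 0") (simp_all add: B_def col0)
  qed
  have e: "e = of_real (Re e)"
    using Bsym[of 0 0] B0[of 0] by (simp add: complex_eq_iff)
  define C where "C = mat n n (\<lambda>(i, j). B $$ (Suc i, Suc j))"
  have C: "C \<in> carrier_mat n n" by (simp add: C_def)
  have "is_hermitian C" unfolding is_hermitian_iff[OF C] by (auto simp: C_def intro: Bsym)
  then obtain U f where Uf: "diagonalises n U f C" using Suc.IH[OF C] by blast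
  note u = diagonalisesD[OF Uf]
  define V where "V = mat ?m ?m (\<lambda>(i, j). case (i, j) of (0, 0) \<Rightarrow> 1 | (Suc i, Suc j) \<Rightarrow> U $$ (i, j)
    | _ \<Rightarrow> 0)"
  define g where "g j = (case j of 0 \<Rightarrow> Re e | Suc j \<Rightarrow> f j)" for j
  have V: "V \<in> carrier_mat ?m ?m" by (simp add: V_def)
  have Vi: "V $$ (0, 0) = 1" "j < n \<Longrightarrow> V $$ (0, Suc j) = 0" "j < n \<Longrightarrow> V $$ (Suc j, 0) = 0"
    "i < n \<Longrightarrow> j < n \<Longrightarrow> V $$ (Suc i, Suc j) = U $$ (i, j)" for i j
    by (auto simp: V_def)
  have uV: "unitary_mat ?m V"
  proof (rule unitary_matI_sum[OF V])
    fix i j assume "i < ?m" "j < ?m"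
    then show "(\<Sum>k<?m. cnj (V $$ (k, i)) * V $$ (k, j)) = (if i = j then 1 else 0)"
      by (cases i; cases j)
        (simp_all add: sum.lessThan_Suc_shift Vi unitary_sum(1)[OF u(1)] del: sum.lessThan_Suc)
  qed
  have "diagonalises ?m V g B"
  proof (rule diagonalisesI[OF uV B])
    fix i j assume "i < ?m" "j < ?m"
    then show "B $$ (i, j) = (\<Sum>k<?m. complex_of_real (g k) * (V $$ (i, k) * cnj (V $$ (j, k))))"
      using B0 e u(4)[of "i - 1" "j - 1"]
      by (cases i; cases j)
        (simp_all add: sum.lessThan_Suc_shift Vi g_def C_def del: sum.lessThan_Suc)
  qed
  then have Bd: "B = V * real_diag_mat ?m g * mat_adjoint V" by (simp add: diagonalises_def)
  have "A = W * B * mat_adjoint W"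
    unfolding B_def by (rule unitary_conj_cancel[symmetric]) (use W Suc.prems in auto)
  also have "\<dots> = (W * V) * real_diag_mat ?m g * mat_adjoint (W * V)"
    unfolding Bd using w V 
    by (simp add: mat_adjoint_mult[of _ ?m ?m _ ?m] assoc_mult_mat[of _ ?m ?m _ ?m _ ?m])
  finally have "diagonalises ?m (W * V) g A"
    using unitary_mat_mult[OF W uV] by (simp add: diagonalises_def)
  then show ?case by blast
qed

lemma cmod_square: "(complex_of_real (cmod z))\<^sup>2 = z * cnj z"
  by (metis complex_norm_square of_real_power)

lemma Re_of_real_mult: "Re (complex_of_real r * z) = r * Re z"
  by simp

lemma unitary_cancel:
  assumes "unitary_mat n U" "A \<in> carrier_mat n n"
  shows "mat_adjoint U * (U * A) = A" "U * (mat_adjoint U * A) = A"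
proof -
  note u = unitary_matD[OF assms(1)]
  show "mat_adjoint U * (U * A) = A"
    by (subst assoc_mult_mat[symmetric, of _ n n _ n _ n]) (use u assms in auto)
  show "U * (mat_adjoint U * A) = A"
    by (subst assoc_mult_mat[symmetric, of _ n n _ n _ n]) (use u assms in auto)
qed

lemma mat_trace_conj:
  assumes "unitary_mat n U" "A \<in> carrier_mat n n"
  shows "mat_trace (U * A * mat_adjoint U) = mat_trace A"
proof -
  note u = unitary_matD[OF assms(1)]
  have "mat_trace (U * A * mat_adjoint U) = mat_trace (mat_adjoint U * (U * A))"
    by (rule mat_trace_mult_comm) (use u assms in auto)
  then show ?thesis by (simp add: unitary_cancel[OF assms])
qed

section \<open>Functional calculus\<close>

text \<open>The unitary \<open>W\<close> between the two eigenbases intertwines the diagonal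
  matrices, so an entry of \<open>W\<close> vanishes unless its two eigenvalues agree. It therefore
  intertwines their images under every \<open>f\<close>. This makes the choice in
  \<open>herm_fun\<close> unambiguous.\<close>

lemma diagonalises_unique:
  assumes "diagonalises n U e A" "diagonalises n V e' A"
  shows "U * real_diag_mat n (\<lambda>i. f (e i)) * mat_adjoint U
    = V * real_diag_mat n (\<lambda>i. f (e' i)) * mat_adjoint V"
proof -
  note u = diagonalisesD(1)[OF assms(1)] and v = diagonalisesD(1)[OF assms(2)]
  note u' = unitary_matD[OF u] and v' = unitary_matD[OF v]
  note [simp] = assoc_mult_mat[of _ n n _ n _ n] unitary_cancel[OF u] unitary_cancel[OF v]
  define W where "W = mat_adjoint V * U"
  have W: "W \<in> carrier_mat n n" using u' v' by (simp add: W_def)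
  have "mat_adjoint V * A * U = real_diag_mat n e' * W"
    using assms(2) u' v' by (simp add: diagonalises_def W_def)
  moreover have "mat_adjoint V * A * U = W * real_diag_mat n e"
    using assms(1) u' v' by (simp add: diagonalises_def W_def)
  ultimately have "real_diag_mat n e' * W = W * real_diag_mat n e" by simp
  then have eq: "(real_diag_mat n e' * W) $$ (i, j) = (W * real_diag_mat n e) $$ (i, j)" for i j
    by simp
  have "real_diag_mat n (\<lambda>i. f (e' i)) * W = W * real_diag_mat n (\<lambda>i. f (e i))"
  proof (rule eq_matI)
    fix i j assume "i < dim_row (W * real_diag_mat n (\<lambda>i. f (e i)))"
      "j < dim_col (W * real_diag_mat n (\<lambda>i. f (e i)))"
    then have ij: "i < n" "j < n" using W by auto
    then have "of_real (e' i) * W $$ (i, j) = W $$ (i, j) * of_real (e j)"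
      using eq[of i j] W
      by (simp add: mult_real_diag_index[of _ n] real_diag_mult_index[of _ n n] del: index_mult_mat(1))
    then have "W $$ (i, j) = 0 \<or> e' i = e j" by auto
    then have "of_real (f (e' i)) * W $$ (i, j) = W $$ (i, j) * of_real (f (e j))" by auto
    then show "(real_diag_mat n (\<lambda>i. f (e' i)) * W) $$ (i, j)
        = (W * real_diag_mat n (\<lambda>i. f (e i))) $$ (i, j)"
      using ij W by (simp add: mult_real_diag_index[of _ n] real_diag_mult_index[of _ n n]
          del: index_mult_mat(1))
  qed (use W in auto)
  then have "V * (real_diag_mat n (\<lambda>i. f (e' i)) * W) * mat_adjoint U
      = V * (W * real_diag_mat n (\<lambda>i. f (e i))) * mat_adjoint U" by simp
  then show ?thesis using u' v' by (simp add: W_def)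
qed

lemma herm_fun_eq:
  assumes "diagonalises n U e A"
  shows "herm_fun f A = U * real_diag_mat n (\<lambda>i. f (e i)) * mat_adjoint U"
proof -
  have dim: "dim_row A = n" using diagonalisesD[OF assms] by auto
  have "\<exists>B U e. is_unitary U \<and> dim_row U = dim_row A \<and>
      A = U * real_diag_mat (dim_row A) e * mat_adjoint U \<and>
      B = U * real_diag_mat (dim_row A) (\<lambda>i. f (e i)) * mat_adjoint U"
    using assms unfolding diagonalises_def unitary_mat_iff dim by blast
  from someI_ex[OF this, folded herm_fun_def] obtain V e' where
    "diagonalises n V e' A" "herm_fun f A = V * real_diag_mat n (\<lambda>i. f (e' i)) * mat_adjoint V"
    unfolding diagonalises_def unitary_mat_iff dim by blast
  then show ?thesis using diagonalises_unique[OF assms] by metis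
qed

lemma herm_fun_diagonalises:
  assumes "diagonalises n U e A"
  shows "diagonalises n U (\<lambda>i. f (e i)) (herm_fun f A)"
  using diagonalisesD(1)[OF assms] unfolding diagonalises_def herm_fun_eq[OF assms] by simp

lemmas mat_log2_diagonalises = herm_fun_diagonalises[where f = "log 2", folded mat_log2_def]

section \<open>Overlaps of eigenbases\<close>

text \<open>The transition probability between eigenvector \<open>i\<close> of one operator and
  eigenvector \<open>j\<close> of another. With these weights, traces of products of functions of
  two non-commuting operators become classical double sums.\<close>

definition overlap :: "complex mat \<Rightarrow> complex mat \<Rightarrow> nat \<Rightarrow> nat \<Rightarrow> real" where
  "overlap U V i j = (cmod ((mat_adjoint V * U) $$ (j, i)))\<^sup>2"

lemma sum_overlap:
  assumes "unitary_mat n U" "unitary_mat n V" "i < n"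
  shows "(\<Sum>j<n. overlap U V i j) = 1"
proof -
  have "complex_of_real (\<Sum>j<n. overlap U V i j)
     = (\<Sum>j<n. cnj ((mat_adjoint V * U) $$ (j, i)) * (mat_adjoint V * U) $$ (j, i))"
    by (simp add: overlap_def cmod_square mult.commute del: index_mult_mat(1))
  also have "\<dots> = 1"
    using unitary_sum(1)[OF unitary_mat_mult[OF unitary_mat_adjoint[OF assms(2)] assms(1)] assms(3,3)]
    by simp
  finally show ?thesis using of_real_eq_1_iff by blast
qed

lemma overlap_self:
  assumes "unitary_mat n U" "i < n" "j < n"
  shows "overlap U U i j = (if i = j then 1 else 0)"
  using assms unitary_matD[OF assms(1)] by (auto simp: overlap_def simp del: index_mult_mat(1))

lemma trace_quadratic_diag:
  assumes Y: "Y \<in> carrier_mat n n"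
  shows "mat_trace (mat_adjoint Y * (real_diag_mat n q * Y))
      = of_real (\<Sum>i<n. \<Sum>j<n. q j * (cmod (Y $$ (j, i)))\<^sup>2)"
    and "mat_trace (Y * (real_diag_mat n p * mat_adjoint Y))
      = of_real (\<Sum>i<n. \<Sum>j<n. p i * (cmod (Y $$ (j, i)))\<^sup>2)"
proof -
  have "mat_trace (mat_adjoint Y * (real_diag_mat n q * Y))
      = (\<Sum>i<n. \<Sum>j<n. cnj (Y $$ (j, i)) * (of_real (q j) * Y $$ (j, i)))"
    using Y by (subst mat_trace_mult[of _ n n])
      (auto simp: real_diag_mult_index[of _ n n] simp del: index_mult_mat(1))
  then show "mat_trace (mat_adjoint Y * (real_diag_mat n q * Y))
      = of_real (\<Sum>i<n. \<Sum>j<n. q j * (cmod (Y $$ (j, i)))\<^sup>2)"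
    by (simp add: cmod_square mult_ac)
  have "mat_trace (Y * (real_diag_mat n p * mat_adjoint Y))
      = (\<Sum>j<n. \<Sum>i<n. Y $$ (j, i) * (of_real (p i) * cnj (Y $$ (j, i))))"
    using Y by (subst mat_trace_mult[of _ n n])
      (auto simp: real_diag_mult_index[of _ n n] simp del: index_mult_mat(1))
  then show "mat_trace (Y * (real_diag_mat n p * mat_adjoint Y))
      = of_real (\<Sum>i<n. \<Sum>j<n. p i * (cmod (Y $$ (j, i)))\<^sup>2)"
    by (subst (asm) sum.swap) (simp add: cmod_square mult_ac)
qed

lemma trace_mult_diagonalised:
  assumes "diagonalises n U p R" "diagonalises n V q T"
  shows "mat_trace (R * T) = of_real (\<Sum>i<n. \<Sum>j<n. overlap U V i j * (p i * q j))"
proof -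
  note u = diagonalisesD(1)[OF assms(1)] and v = diagonalisesD(1)[OF assms(2)]
  note u' = unitary_matD[OF u] and v' = unitary_matD[OF v]
  note [simp] = assoc_mult_mat[of _ n n _ n _ n] unitary_cancel[OF u] unitary_cancel[OF v]
    mat_adjoint_mult[of _ n n _ n]
  define W where "W = mat_adjoint V * U"
  have W: "W \<in> carrier_mat n n" using u' v' by (simp add: W_def)
  have "R * T = U * (real_diag_mat n p * (mat_adjoint W * (real_diag_mat n q * W))) * mat_adjoint U"
    using assms u' v' by (simp add: diagonalises_def W_def)
  then have "mat_trace (R * T) = mat_trace (real_diag_mat n p * (mat_adjoint W * (real_diag_mat n q * W)))"
    using W by (simp add: mat_trace_conj[OF u] del: assoc_mult_mat)
  also have "\<dots> = (\<Sum>i<n. of_real (p i) * (mat_adjoint W * (real_diag_mat n q * W)) $$ (i, i))"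
    using W by (subst mat_trace_carrier[of _ n n])
      (auto simp: real_diag_mult_index[of _ n n] simp del: index_mult_mat(1))
  also have "\<dots> = (\<Sum>i<n. of_real (p i) * (\<Sum>j<n. cnj (W $$ (j, i)) * (of_real (q j) * W $$ (j, i))))"
    using W by (intro sum.cong refl, subst mult_mat_index[of _ n n _ n])
      (auto simp: real_diag_mult_index[of _ n n] simp del: index_mult_mat(1))
  also have "\<dots> = of_real (\<Sum>i<n. \<Sum>j<n. overlap U V i j * (p i * q j))"
    by (simp add: overlap_def W_def[symmetric] cmod_square sum_distrib_left mult_ac)
  finally show ?thesis .
qed

lemma trace_diagonalised:
  assumes "diagonalises n U p R"
  shows "mat_trace R = of_real (\<Sum>i<n. p i)"
  using assms unitary_matD[OF diagonalisesD(1)[OF assms]]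
  by (simp add: diagonalises_def mat_trace_conj[of n])
     (simp add: mat_trace_def real_diag_mat_def)

section \<open>A variational formula\<close>

text \<open>For commuting arguments \<open>g t = \<Sum> p\<^sup>2 / (q + t p)\<close>. Integrating \<open>g t - 1 / (1 + t)\<close> over \<open>t \<ge> 0\<close>
  gives the relative entropy, and \<open>g t\<close> is the maximum of \<open>variational_form\<close>, which can only
  decrease if its argument is restricted to a subsystem.\<close>

definition resolvent_overlap ::
    "nat \<Rightarrow> complex mat \<Rightarrow> (nat \<Rightarrow> real) \<Rightarrow> complex mat \<Rightarrow> (nat \<Rightarrow> real) \<Rightarrow> real \<Rightarrow> real" where
  "resolvent_overlap n U p V q t
    = (\<Sum>i<n. \<Sum>j<n. overlap U V i j * ((p i)\<^sup>2 / (q j + t * p i)))"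

definition variational_form :: "complex mat \<Rightarrow> complex mat \<Rightarrow> real \<Rightarrow> complex mat \<Rightarrow> real" where
  "variational_form R T t X = 2 * Re (mat_trace (mat_adjoint X * R))
     - Re (mat_trace (mat_adjoint X * (T * X))) - t * Re (mat_trace (X * (R * mat_adjoint X)))"

text \<open>Written in the eigenbases of \<open>R\<close> and \<open>T\<close>, the quadratic form
  decouples: each entry of \<open>Y\<close> has its own scalar quadratic, which can be maximised
  separately.\<close>

lemma variational_form_diagonalised:
  assumes "diagonalises n U p R" "diagonalises n V q T" "Y \<in> carrier_mat n n"
  shows "variational_form R T t (V * Y * mat_adjoint U) = (\<Sum>i<n. \<Sum>j<n.
      2 * p i * Re (cnj (Y $$ (j, i)) * (mat_adjoint V * U) $$ (j, i))
      - (q j + t * p i) * (cmod (Y $$ (j, i)))\<^sup>2)"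
proof -
  note u = diagonalisesD(1)[OF assms(1)] and v = diagonalisesD(1)[OF assms(2)]
  note u' = unitary_matD[OF u] and v' = unitary_matD[OF v]
  note simps = assoc_mult_mat[of _ n n _ n _ n] unitary_cancel[OF u] unitary_cancel[OF v]
    mat_adjoint_mult[of _ n n _ n]
  define W where "W = mat_adjoint V * U"
  define X where "X = V * Y * mat_adjoint U"
  have W: "W \<in> carrier_mat n n" using u' v' by (simp add: W_def)
  have "mat_adjoint X * R = U * (mat_adjoint Y * (W * real_diag_mat n p)) * mat_adjoint U"
    using assms u' v' by (simp add: diagonalises_def W_def X_def simps)
  then have 1: "mat_trace (mat_adjoint X * R) = mat_trace (mat_adjoint Y * (W * real_diag_mat n p))"
    using W assms(3) by (simp add: mat_trace_conj[OF u])
  have "mat_adjoint X * (T * X) = U * (mat_adjoint Y * (real_diag_mat n q * Y)) * mat_adjoint U"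
    using assms u' v' by (simp add: diagonalises_def X_def simps)
  then have 2: "mat_trace (mat_adjoint X * (T * X)) = mat_trace (mat_adjoint Y * (real_diag_mat n q * Y))"
    using assms(3) by (simp add: mat_trace_conj[OF u])
  have "X * (R * mat_adjoint X) = V * (Y * (real_diag_mat n p * mat_adjoint Y)) * mat_adjoint V"
    using assms u' v' by (simp add: diagonalises_def X_def simps)
  then have 3: "mat_trace (X * (R * mat_adjoint X)) = mat_trace (Y * (real_diag_mat n p * mat_adjoint Y))"
    using assms(3) by (simp add: mat_trace_conj[OF v])
  have "mat_trace (mat_adjoint Y * (W * real_diag_mat n p))
      = (\<Sum>i<n. \<Sum>j<n. of_real (p i) * (cnj (Y $$ (j, i)) * W $$ (j, i)))"
    using W assms(3) by (subst mat_trace_mult[of _ n n])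
      (auto simp: mult_real_diag_index[of _ n] mult_ac simp del: index_mult_mat(1))
  then have 4: "Re (mat_trace (mat_adjoint Y * (W * real_diag_mat n p)))
      = (\<Sum>i<n. \<Sum>j<n. p i * Re (cnj (Y $$ (j, i)) * W $$ (j, i)))"
    by (simp only: Re_sum Re_of_real_mult)
  show ?thesis
    unfolding variational_form_def X_def[symmetric] W_def[symmetric] 1 2 3 4
      trace_quadratic_diag[OF assms(3)] Re_complex_of_real
    unfolding sum_distrib_left sum_subtractf[symmetric]
    by (intro sum.cong refl) (simp add: algebra_simps)
qed

text \<open>Completing the square, with equality at \<open>y = (p / r) a\<close>.\<close>

lemma complete_square_bound:
  fixes y a :: complex and r :: real
  assumes "r > 0"
  shows "2 * p * Re (cnj y * a) - r * (cmod y)\<^sup>2 \<le> (cmod a)\<^sup>2 * (p\<^sup>2 / r)"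
proof -
  have "0 \<le> (cmod (of_real p * a - of_real r * y))\<^sup>2" by simp
  also have "\<dots> = p\<^sup>2 * (cmod a)\<^sup>2 - 2 * p * r * Re (cnj y * a) + r\<^sup>2 * (cmod y)\<^sup>2"
    unfolding cmod_power2 by (simp add: power2_eq_square algebra_simps)
  finally have "r * (2 * p * Re (cnj y * a) - r * (cmod y)\<^sup>2) \<le> p\<^sup>2 * (cmod a)\<^sup>2"
    by (simp add: algebra_simps power2_eq_square)
  then show ?thesis using assms by (simp add: field_simps)
qed

lemma variational_form_le:
  assumes R: "diagonalises n U p R" and T: "diagonalises n V q T" and X: "X \<in> carrier_mat n n"
    and p: "\<And>i. i < n \<Longrightarrow> 0 \<le> p i" and q: "\<And>i. i < n \<Longrightarrow> 0 < q i" and t: "0 \<le> t"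
  shows "variational_form R T t X \<le> resolvent_overlap n U p V q t"
proof -
  note u = diagonalisesD(1)[OF R] and v = diagonalisesD(1)[OF T]
  note u' = unitary_matD[OF u] and v' = unitary_matD[OF v]
  define Y where "Y = mat_adjoint V * X * U"
  have Y: "Y \<in> carrier_mat n n" using u' v' X by (simp add: Y_def)
  have "V * Y * mat_adjoint U = X"
    using u' v' X by (simp add: Y_def assoc_mult_mat[of _ n n _ n _ n] unitary_cancel[OF v])
  then have "variational_form R T t X = (\<Sum>i<n. \<Sum>j<n.
      2 * p i * Re (cnj (Y $$ (j, i)) * (mat_adjoint V * U) $$ (j, i))
      - (q j + t * p i) * (cmod (Y $$ (j, i)))\<^sup>2)"
    using variational_form_diagonalised[OF R T Y] by simp
  also have "\<dots> \<le> resolvent_overlap n U p V q t"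
    unfolding resolvent_overlap_def overlap_def
    by (intro sum_mono complete_square_bound add_pos_nonneg) (use p q t in auto)
  finally show ?thesis .
qed

lemma variational_form_attained:
  assumes R: "diagonalises n U p R" and T: "diagonalises n V q T"
    and p: "\<And>i. i < n \<Longrightarrow> 0 \<le> p i" and q: "\<And>i. i < n \<Longrightarrow> 0 < q i" and t: "0 \<le> t"
  shows "\<exists>X \<in> carrier_mat n n. variational_form R T t X = resolvent_overlap n U p V q t"
proof -
  note u = diagonalisesD(1)[OF R] and v = diagonalisesD(1)[OF T]
  note u' = unitary_matD[OF u] and v' = unitary_matD[OF v]
  define W where "W = mat_adjoint V * U"
  \<comment> \<open>Each entry is the equality case of \<open>complete_square_bound\<close>, with
    \<open>r = q j + t * p i\<close> and \<open>a\<close> the entry of \<open>W\<close>.\<close>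
  define Y where "Y = mat n n (\<lambda>(j, i). of_real (p i / (q j + t * p i)) * W $$ (j, i))"
  have Y: "Y \<in> carrier_mat n n" by (simp add: Y_def)
  have "2 * p i * Re (cnj (Y $$ (j, i)) * W $$ (j, i)) - (q j + t * p i) * (cmod (Y $$ (j, i)))\<^sup>2
      = overlap U V i j * ((p i)\<^sup>2 / (q j + t * p i))" if "i < n" "j < n" for i j
  proof -
    define r where "r = q j + t * p i"
    have r: "r > 0" unfolding r_def using p[OF that(1)] q[OF that(2)] t
      by (simp add: add_pos_nonneg)
    have Yji: "Y $$ (j, i) = of_real (p i / r) * W $$ (j, i)" using that by (simp add: Y_def r_def)
    have "Re (cnj (Y $$ (j, i)) * W $$ (j, i)) = p i / r * (cmod (W $$ (j, i)))\<^sup>2"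
      unfolding Yji cmod_power2 by (simp add: power2_eq_square algebra_simps add_divide_distrib)
    moreover have "(cmod (Y $$ (j, i)))\<^sup>2 = (p i / r)\<^sup>2 * (cmod (W $$ (j, i)))\<^sup>2"
      unfolding Yji norm_mult norm_of_real by (simp add: power_mult_distrib power_divide)
    ultimately show ?thesis using r
      unfolding overlap_def W_def[symmetric] r_def[symmetric]
      by (simp only:) (simp add: field_simps power2_eq_square)
  qed
  then have "variational_form R T t (V * Y * mat_adjoint U) = resolvent_overlap n U p V q t"
    unfolding variational_form_diagonalised[OF R T Y] resolvent_overlap_def W_def[symmetric]
    by (intro sum.cong refl) auto
  moreover have "V * Y * mat_adjoint U \<in> carrier_mat n n" using u' v' Y by simp
  ultimately show ?thesis by blast
qed

section \<open>Partial traces and extensions of operators\<close>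

lemma reduced_state_carrier [simp]: "reduced_state d Y X R \<in> carrier_mat (sys_dim d X) (sys_dim d X)"
  by (simp add: reduced_state_def)

lemma extend_op_carrier [simp]: "extend_op d Y X P \<in> carrier_mat (sys_dim d Y) (sys_dim d Y)"
  by (simp add: extend_op_def)

lemma extend_op_index:
  "k < sys_dim d Y \<Longrightarrow> l < sys_dim d Y \<Longrightarrow> extend_op d Y X P $$ (k, l)
    = (if sub_index d Y (Y - X) k = sub_index d Y (Y - X) l
       then P $$ (sub_index d Y X k, sub_index d Y X l) else 0)"
  by (simp add: extend_op_def)

lemma extend_op_add:
  assumes "A \<in> carrier_mat (sys_dim d X) (sys_dim d X)" "B \<in> carrier_mat (sys_dim d X) (sys_dim d X)"
    "\<And>k. sub_index d Y X k < sys_dim d X"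
  shows "extend_op d Y X (A + B) = extend_op d Y X A + extend_op d Y X B"
  using assms by (intro eq_matI) (auto simp: extend_op_def)

context sites
begin

lemma extend_op_glue:
  assumes "Y \<subseteq> V" "X \<subseteq> Y" "a < sys_dim d X" "c < sys_dim d (Y - X)"
    "b < sys_dim d X" "c' < sys_dim d (Y - X)"
  shows "extend_op d Y X P $$ (glue Y X a c, glue Y X b c') = (if c = c' then P $$ (a, b) else 0)"
  using assms by (simp add: extend_op_index glue_less sub_index_glue)

text \<open>The partial trace is the adjoint of \<open>extend_op\<close> for the trace pairing.
  Several later facts on marginals follow from this duality without looking at entries.\<close>

lemma trace_extend_op:
  assumes Y: "Y \<subseteq> V" and X: "X \<subseteq> Y" and R: "R \<in> carrier_mat (sys_dim d Y) (sys_dim d Y)"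
    and P: "P \<in> carrier_mat (sys_dim d X) (sys_dim d X)"
  shows "mat_trace (R * extend_op d Y X P) = mat_trace (reduced_state d Y X R * P)"
proof -
  let ?N = "sys_dim d X" and ?M = "sys_dim d (Y - X)"
  have "mat_trace (R * extend_op d Y X P)
    = (\<Sum>k<sys_dim d Y. \<Sum>l<sys_dim d Y. R $$ (k, l) * extend_op d Y X P $$ (l, k))"
    by (rule mat_trace_mult[OF R extend_op_carrier])
  also have "\<dots> = (\<Sum>a<?N. \<Sum>c<?M. \<Sum>b<?N. \<Sum>c'<?M.
      R $$ (glue Y X a c, glue Y X b c') * (if c' = c then P $$ (b, a) else 0))"
    unfolding sum_index_split[OF Y X]
    by (intro sum.cong refl) (use Y X in \<open>auto simp: extend_op_glue\<close>)
  also have "\<dots> = (\<Sum>a<?N. \<Sum>c<?M. \<Sum>b<?N. R $$ (glue Y X a c, glue Y X b c) * P $$ (b, a))"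
    by (intro sum.cong refl) (simp add: if_distrib[of "\<lambda>x. _ * x"] sum.delta cong: if_cong)
  also have "\<dots> = (\<Sum>a<?N. \<Sum>b<?N. (\<Sum>c<?M. R $$ (glue Y X a c, glue Y X b c)) * P $$ (b, a))"
    unfolding sum_distrib_right by (rule sum.cong[OF refl], rule sum.swap)
  also have "\<dots> = (\<Sum>a<?N. \<Sum>b<?N. reduced_state d Y X R $$ (a, b) * P $$ (b, a))"
    using Y X by (simp add: reduced_state_index)
  also have "\<dots> = mat_trace (reduced_state d Y X R * P)"
    by (rule mat_trace_mult[symmetric]) (use P in auto)
  finally show ?thesis .
qed

lemma extend_op_mult:
  assumes Y: "Y \<subseteq> V" and X: "X \<subseteq> Y"
    and A: "A \<in> carrier_mat (sys_dim d X) (sys_dim d X)"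
    and B: "B \<in> carrier_mat (sys_dim d X) (sys_dim d X)"
  shows "extend_op d Y X (A * B) = extend_op d Y X A * extend_op d Y X B"
proof (rule eq_matI)
  let ?N = "sys_dim d X" and ?M = "sys_dim d (Y - X)"
  have V: "X \<subseteq> V" "Y - X \<subseteq> V" using X Y by auto
  fix k l assume "k < dim_row (extend_op d Y X A * extend_op d Y X B)"
    "l < dim_col (extend_op d Y X A * extend_op d Y X B)"
  then have kl: "k < sys_dim d Y" "l < sys_dim d Y" by (auto simp: extend_op_def)
  define a c where "a = sub_index d Y X k" and "c = sub_index d Y (Y - X) k"
  define b e where "b = sub_index d Y X l" and "e = sub_index d Y (Y - X) l"
  have less: "a < ?N" "c < ?M" "b < ?N" "e < ?M"
    using V by (auto simp: a_def b_def c_def e_def intro: sub_index_less)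
  have k: "k = glue Y X a c" and l: "l = glue Y X b e"
    using glue_sub_index[OF Y X] kl by (simp_all add: a_def b_def c_def e_def)
  have "(extend_op d Y X A * extend_op d Y X B) $$ (k, l)
      = (\<Sum>m<sys_dim d Y. extend_op d Y X A $$ (k, m) * extend_op d Y X B $$ (m, l))"
    by (rule mult_mat_index) (use kl in auto)
  also have "\<dots> = (\<Sum>m<?N. \<Sum>f<?M. if c = f then A $$ (a, m) * (if f = e then B $$ (m, b) else 0) else 0)"
    unfolding sum_index_split[OF Y X] k l
    by (intro sum.cong refl) (use Y X less in \<open>auto simp: extend_op_glue\<close>)
  also have "\<dots> = (\<Sum>m<?N. if c = e then A $$ (a, m) * B $$ (m, b) else 0)"
    by (intro sum.cong refl) (use less in \<open>simp add: sum.delta'\<close>)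
  also have "\<dots> = (if c = e then (A * B) $$ (a, b) else 0)"
    using less by (simp add: mult_mat_index[OF A B] del: index_mult_mat(1))
  also have "\<dots> = extend_op d Y X (A * B) $$ (k, l)"
    unfolding k l using Y X less by (simp add: extend_op_glue del: index_mult_mat(1))
  finally show "extend_op d Y X (A * B) $$ (k, l) = (extend_op d Y X A * extend_op d Y X B) $$ (k, l)"
    by simp
qed (auto simp: extend_op_def)

lemma extend_op_adjoint:
  assumes "X \<subseteq> V" "A \<in> carrier_mat (sys_dim d X) (sys_dim d X)"
  shows "extend_op d Y X (mat_adjoint A) = mat_adjoint (extend_op d Y X A)"
proof (rule eq_matI)
  fix k l assume "k < dim_row (mat_adjoint (extend_op d Y X A))"
    "l < dim_col (mat_adjoint (extend_op d Y X A))"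
  then have "k < sys_dim d Y" "l < sys_dim d Y" by (auto simp: extend_op_def)
  moreover have "dim_row (extend_op d Y X A) = sys_dim d Y" "dim_col (extend_op d Y X A) = sys_dim d Y"
    by (auto simp: extend_op_def)
  ultimately show "extend_op d Y X (mat_adjoint A) $$ (k, l) = mat_adjoint (extend_op d Y X A) $$ (k, l)"
    using assms by (simp add: extend_op_index sub_index_less)
qed (auto simp: extend_op_def)

lemma extend_op_real_diag:
  assumes Y: "Y \<subseteq> V" and X: "X \<subseteq> Y"
  shows "extend_op d Y X (real_diag_mat (sys_dim d X) e)
    = real_diag_mat (sys_dim d Y) (\<lambda>k. e (sub_index d Y X k))"
proof (rule eq_matI)
  have V: "X \<subseteq> V" using X Y by auto
  fix k l assume "k < dim_row (real_diag_mat (sys_dim d Y) (\<lambda>k. e (sub_index d Y X k)))"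
    "l < dim_col (real_diag_mat (sys_dim d Y) (\<lambda>k. e (sub_index d Y X k)))"
  then have kl: "k < sys_dim d Y" "l < sys_dim d Y" by auto
  have "sub_index d Y (Y - X) k = sub_index d Y (Y - X) l \<Longrightarrow>
      sub_index d Y X k = sub_index d Y X l \<Longrightarrow> k = l"
    using glue_sub_index[OF Y X] kl by metis
  then show "extend_op d Y X (real_diag_mat (sys_dim d X) e) $$ (k, l)
      = real_diag_mat (sys_dim d Y) (\<lambda>k. e (sub_index d Y X k)) $$ (k, l)"
    using kl sub_index_less[OF V] by (auto simp: extend_op_index real_diag_mat_def)
qed (auto simp: extend_op_def)

lemma one_mat_eq_real_diag: "1\<^sub>m n = real_diag_mat n (\<lambda>_. 1)"
  by (rule eq_matI) (auto simp: real_diag_mat_def)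

lemma extend_op_one:
  assumes "Y \<subseteq> V" "X \<subseteq> Y"
  shows "extend_op d Y X (1\<^sub>m (sys_dim d X)) = 1\<^sub>m (sys_dim d Y)"
  by (simp add: one_mat_eq_real_diag extend_op_real_diag[OF assms])

text \<open>\<open>extend_op\<close> is a unital homomorphism that respects adjoints and maps real
  diagonal matrices to such matrices, so it carries a diagonalisation along. Positive eigenvalues
  stay positive, and functional calculus commutes with the extension.\<close>

lemma extend_op_diagonalises:
  assumes Y: "Y \<subseteq> V" and X: "X \<subseteq> Y" and A: "diagonalises (sys_dim d X) U e A"
  shows "diagonalises (sys_dim d Y) (extend_op d Y X U) (\<lambda>k. e (sub_index d Y X k)) (extend_op d Y X A)"
proof -
  have V: "X \<subseteq> V" using X Y by auto
  note u = unitary_matD[OF diagonalisesD(1)[OF A]]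
  note ext = extend_op_mult[OF Y X] extend_op_adjoint[OF V] extend_op_real_diag[OF Y X]
  have "unitary_mat (sys_dim d Y) (extend_op d Y X U)"
    using u by (intro unitary_matI) (simp_all add: ext[symmetric] extend_op_one[OF Y X])
  moreover have "extend_op d Y X A = extend_op d Y X U
      * real_diag_mat (sys_dim d Y) (\<lambda>k. e (sub_index d Y X k)) * mat_adjoint (extend_op d Y X U)"
    using A u by (simp add: diagonalises_def ext)
  ultimately show ?thesis by (simp add: diagonalises_def)
qed

lemma extend_op_trans:
  assumes Y: "Y \<subseteq> V" and X: "X \<subseteq> Y" and Z: "Z \<subseteq> X"
  shows "extend_op d Y X (extend_op d X Z P) = extend_op d Y Z P"
proof (rule eq_matI)
  fix k l assume "k < dim_row (extend_op d Y Z P)" "l < dim_col (extend_op d Y Z P)"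
  then have kl: "k < sys_dim d Y" "l < sys_dim d Y" by (auto simp: extend_op_def)
  have V: "X \<subseteq> V" "Y - X \<subseteq> V" "X - Z \<subseteq> V" "Y - Z \<subseteq> V" using X Y by auto
  have "(sub_index d Y (Y - X) k = sub_index d Y (Y - X) l
      \<and> sub_index d X (X - Z) (sub_index d Y X k) = sub_index d X (X - Z) (sub_index d Y X l))
    \<longleftrightarrow> sub_index d Y (Y - Z) k = sub_index d Y (Y - Z) l"
    using X Z sub_index_trans[OF V(1), of "X - Z" Y] by (auto simp: sub_index_eq_iff V)
  then show "extend_op d Y X (extend_op d X Z P) $$ (k, l) = extend_op d Y Z P $$ (k, l)"
    using kl sub_index_less[OF V(1)] sub_index_trans[OF V(1) Z, of Y]
    by (auto simp: extend_op_index)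
qed (auto simp: extend_op_def)

text \<open>By duality this is \<open>extend_op_trans\<close>. Pairing with the matrix unit at the
  transposed position \<open>(j, i)\<close> recovers the entry \<open>(i, j)\<close>.\<close>

lemma reduced_state_trans:
  assumes Y: "Y \<subseteq> V" and X: "X \<subseteq> Y" and Z: "Z \<subseteq> X"
    and R: "R \<in> carrier_mat (sys_dim d Y) (sys_dim d Y)"
  shows "reduced_state d X Z (reduced_state d Y X R) = reduced_state d Y Z R"
proof (rule eq_matI)
  let ?n = "sys_dim d Z"
  have V: "X \<subseteq> V" "Z \<subseteq> Y" using X Y Z by auto
  fix i j assume "i < dim_row (reduced_state d Y Z R)" "j < dim_col (reduced_state d Y Z R)"
  then have ij: "i < ?n" "j < ?n" by (auto simp: reduced_state_def)
  define E where "E = mat ?n ?n (\<lambda>(a, b). if a = j \<and> b = i then 1 else (0::complex))"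
  have E: "E \<in> carrier_mat ?n ?n" by (simp add: E_def)
  have entry: "mat_trace (A * E) = A $$ (i, j)" if "A \<in> carrier_mat ?n ?n" for A
  proof -
    have "mat_trace (A * E) = (\<Sum>a<?n. \<Sum>b<?n. if b = j then if a = i then A $$ (a, b) else 0 else 0)"
      unfolding mat_trace_mult[OF that E] by (intro sum.cong refl) (auto simp: E_def)
    then show ?thesis using ij by (simp add: sum.delta)
  qed
  have "mat_trace (reduced_state d X Z (reduced_state d Y X R) * E) = mat_trace (reduced_state d Y Z R * E)"
    using E R
    by (simp add: trace_extend_op[OF V(1) Z, symmetric] trace_extend_op[OF Y X, symmetric]
        trace_extend_op[OF Y V(2), symmetric] extend_op_trans[OF Y X Z])
  then show "reduced_state d X Z (reduced_state d Y X R) $$ (i, j) = reduced_state d Y Z R $$ (i, j)"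
    by (simp add: entry)
qed (auto simp: reduced_state_def)

lemma reduced_state_self:
  assumes Y: "Y \<subseteq> V" and R: "R \<in> carrier_mat (sys_dim d Y) (sys_dim d Y)"
  shows "reduced_state d Y Y R = R"
proof (rule eq_matI)
  fix i j assume "i < dim_row R" "j < dim_col R"
  then have ij: "i < sys_dim d Y" "j < sys_dim d Y" using R by auto
  have "glue Y Y i c = i" if "i < sys_dim d Y" for i c
    unfolding glue_def using Y that dim_pos config_index_digits[of Y d i]
    by (auto cong: config_index_cong)
  then show "reduced_state d Y Y R $$ (i, j) = R $$ (i, j)"
    using Y ij by (simp add: reduced_state_index)
qed (use R in \<open>auto simp: reduced_state_def\<close>)

text \<open>Tracing out \<open>B - A\<close> does not touch the identity factor on
  \<open>A - B\<close>, so no dimension factor appears. Strong subadditivity rests on this commuting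
  square.\<close>

lemma reduced_state_extend_op:
  assumes A: "A \<subseteq> V" and B: "B \<subseteq> V" and T: "T \<in> carrier_mat (sys_dim d B) (sys_dim d B)"
  shows "reduced_state d (A \<union> B) A (extend_op d (A \<union> B) B T)
    = extend_op d A (A \<inter> B) (reduced_state d B (A \<inter> B) T)"
proof (rule eq_matI)
  let ?Y = "A \<union> B" and ?C = "A \<inter> B"
  have Y: "?Y \<subseteq> V" and C: "?C \<subseteq> V" "A - B \<subseteq> V" using A B by auto
  have diffs: "?Y - A = B - ?C" "?Y - B = A - ?C" "B - A = B - ?C" "A - B = A - ?C" by auto
  fix a b assume "a < dim_row (extend_op d A ?C (reduced_state d B ?C T))"
    "b < dim_col (extend_op d A ?C (reduced_state d B ?C T))"
  then have ab: "a < sys_dim d A" "b < sys_dim d A" by (auto simp: extend_op_def)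
  have gl: "sub_index d ?Y B (glue ?Y A a c) = glue B ?C (sub_index d A ?C a) c"
    if "c < sys_dim d (B - ?C)" for a c
    by (rule index_eqI[OF B])
      (use A B Y C in \<open>auto simp: sub_index_less glue_less site_digit_sub_index site_digit_glue diffs\<close>)
  have cond: "sub_index d ?Y (?Y - B) (glue ?Y A a c) = sub_index d ?Y (?Y - B) (glue ?Y A b c)
    \<longleftrightarrow> sub_index d A (A - ?C) a = sub_index d A (A - ?C) b" for c
    using Y C by (auto simp: sub_index_eq_iff site_digit_glue diffs)
  have "reduced_state d ?Y A (extend_op d ?Y B T) $$ (a, b)
    = (\<Sum>c<sys_dim d (B - ?C). if sub_index d A (A - ?C) a = sub_index d A (A - ?C) b
        then T $$ (glue B ?C (sub_index d A ?C a) c, glue B ?C (sub_index d A ?C b) c) else 0)"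
    unfolding reduced_state_index[OF Y Un_upper1 ab] diffs(1)
    using Y by (intro sum.cong refl) (simp add: extend_op_index glue_less gl cond diffs(1))
  also have "\<dots> = extend_op d A ?C (reduced_state d B ?C T) $$ (a, b)"
    using ab B C by (simp add: extend_op_index reduced_state_index sub_index_less)
  finally show "reduced_state d ?Y A (extend_op d ?Y B T) $$ (a, b)
    = extend_op d A ?C (reduced_state d B ?C T) $$ (a, b)" .
qed (auto simp: extend_op_def reduced_state_def)

lemma reduced_state_hermitian:
  assumes "Y \<subseteq> V" "X \<subseteq> Y" "R \<in> carrier_mat (sys_dim d Y) (sys_dim d Y)" "is_hermitian R"
  shows "is_hermitian (reduced_state d Y X R)"
  unfolding is_hermitian_iff[OF reduced_state_carrier]
proof (intro allI impI)
  fix a b assume ab: "a < sys_dim d X" "b < sys_dim d X"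
  have "R $$ (glue Y X a c, glue Y X b c) = cnj (R $$ (glue Y X b c, glue Y X a c))" for c
    using assms(4) glue_less[OF assms(1)] unfolding is_hermitian_iff[OF assms(3)] by blast
  then have "(\<Sum>c<sys_dim d (Y - X). R $$ (glue Y X a c, glue Y X b c))
      = (\<Sum>c<sys_dim d (Y - X). cnj (R $$ (glue Y X b c, glue Y X a c)))"
    by (intro sum.cong refl)
  then show "reduced_state d Y X R $$ (a, b) = cnj (reduced_state d Y X R $$ (b, a))"
    using ab by (simp add: reduced_state_index[OF assms(1,2)] cnj_sum)
qed

lemma mat_trace_reduced_state:
  assumes "Y \<subseteq> V" "X \<subseteq> Y" "R \<in> carrier_mat (sys_dim d Y) (sys_dim d Y)"
  shows "mat_trace (reduced_state d Y X R) = mat_trace R"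
  using trace_extend_op[OF assms, of "1\<^sub>m (sys_dim d X)"] assms(3)
    right_mult_one_mat[OF reduced_state_carrier, of d Y X R]
  by (simp add: extend_op_one[OF assms(1,2)])

end

section \<open>States\<close>

text \<open>Density matrices with positivity as an explicit double sum over entries, a form suited
  to splitting indices. Only the real part is tested, as the form of a Hermitian matrix is
  real.\<close>

definition state :: "nat \<Rightarrow> complex mat \<Rightarrow> bool" where
  "state n R \<longleftrightarrow> R \<in> carrier_mat n n \<and> is_hermitian R \<and>
     (\<forall>x. 0 \<le> Re (\<Sum>i<n. \<Sum>j<n. cnj (x i) * R $$ (i, j) * x j)) \<and> mat_trace R = 1"

lemma density_matrix_state:
  assumes "density_matrix n R"
  shows "state n R"
proof -
  have R: "R \<in> carrier_mat n n" using assms by (simp add: density_matrix_def)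
  have "0 \<le> Re (\<Sum>i<n. \<Sum>j<n. cnj (x i) * R $$ (i, j) * x j)" for x
  proof -
    have "0 \<le> (R *\<^sub>v vec n x) \<bullet>c vec n x" using assms by (simp add: density_matrix_def)
    moreover have "(R *\<^sub>v vec n x) \<bullet>c vec n x = (\<Sum>i<n. \<Sum>j<n. cnj (x i) * R $$ (i, j) * x j)"
      using R by (simp add: scalar_prod_def lessThan_atLeast0 sum_distrib_right sum_distrib_left mult_ac)
    ultimately show ?thesis by (simp add: less_eq_complex_def)
  qed
  then show ?thesis using assms by (simp add: state_def density_matrix_def)
qed

lemma state_diagonalised:
  assumes "state n R" "diagonalises n U p R"
  shows "i < n \<Longrightarrow> 0 \<le> p i" and "(\<Sum>i<n. p i) = 1"
proof -
  note u = unitary_matD[OF diagonalisesD(1)[OF assms(2)]]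
  have R: "R \<in> carrier_mat n n" using assms(1) by (simp add: state_def)
  show "0 \<le> p i" if i: "i < n"
  proof -
    have "mat_adjoint U * (R * U) = real_diag_mat n p"
      using assms(2) u by (simp add: diagonalises_def assoc_mult_mat[of _ n n _ n _ n]
          unitary_cancel[OF diagonalisesD(1)[OF assms(2)]])
    then have "of_real (p i) = (mat_adjoint U * (R * U)) $$ (i, i)"
      using i by (simp add: real_diag_mat_def del: index_mult_mat(1))
    also have "\<dots> = (\<Sum>k<n. cnj (U $$ (k, i)) * (\<Sum>l<n. R $$ (k, l) * U $$ (l, i)))"
      using u(1) R i by (subst mult_mat_index[of _ n n _ n])
        (auto simp: mult_mat_index[OF R u(1)] simp del: index_mult_mat(1))
    also have "\<dots> = (\<Sum>k<n. \<Sum>l<n. cnj (U $$ (k, i)) * R $$ (k, l) * U $$ (l, i))"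
      by (simp add: sum_distrib_left mult.assoc)
    finally have "p i = Re \<dots>" by (metis Re_complex_of_real)
    \<comment> \<open>Positivity is tested on the eigenvector, which is column \<open>i\<close> of
      \<open>U\<close>.\<close>
    moreover have "0 \<le> Re (\<Sum>k<n. \<Sum>l<n. cnj (U $$ (k, i)) * R $$ (k, l) * U $$ (l, i))"
      using assms(1) unfolding state_def by (elim conjE allE[of _ "\<lambda>k. U $$ (k, i)"])
    ultimately show ?thesis by simp
  qed
  have "complex_of_real (\<Sum>i<n. p i) = 1"
    using trace_diagonalised[OF assms(2)] assms(1) by (simp add: state_def)
  then show "(\<Sum>i<n. p i) = 1" by (simp only: of_real_eq_1_iff)
qed

lemma diagonalised_state:
  assumes "diagonalises n U p R" "\<And>i. i < n \<Longrightarrow> 0 \<le> p i" "(\<Sum>i<n. p i) = 1"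
  shows "state n R"
  unfolding state_def
proof (intro conjI allI)
  note R = diagonalisesD[OF assms(1)]
  show "R \<in> carrier_mat n n" by (rule R)
  show "is_hermitian R" by (rule diagonalises_imp_hermitian[OF assms(1)])
  show "mat_trace R = 1" using trace_diagonalised[OF assms(1)] assms(3) by simp
  fix x :: "nat \<Rightarrow> complex"
  define y where "y k = (\<Sum>i<n. cnj (x i) * U $$ (i, k))" for k
  have "(\<Sum>i<n. \<Sum>j<n. cnj (x i) * R $$ (i, j) * x j)
      = (\<Sum>i<n. \<Sum>j<n. \<Sum>k<n. of_real (p k) * ((cnj (x i) * U $$ (i, k)) * cnj (cnj (x j) * U $$ (j, k))))"
    by (intro sum.cong refl) (simp add: R(4) sum_distrib_left sum_distrib_right mult_ac)
  also have "\<dots> = (\<Sum>i<n. \<Sum>k<n. \<Sum>j<n. of_real (p k) * ((cnj (x i) * U $$ (i, k)) * cnj (cnj (x j) * U $$ (j, k))))"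
    by (rule sum.cong[OF refl], rule sum.swap)
  also have "\<dots> = (\<Sum>k<n. \<Sum>i<n. \<Sum>j<n. of_real (p k) * ((cnj (x i) * U $$ (i, k)) * cnj (cnj (x j) * U $$ (j, k))))"
    by (rule sum.swap)
  also have "\<dots> = (\<Sum>k<n. of_real (p k) * (y k * cnj (y k)))"
    unfolding y_def cnj_sum sum_product by (simp only: sum_distrib_left)
  also have "\<dots> = of_real (\<Sum>k<n. p k * (cmod (y k))\<^sup>2)"
    by (simp add: cmod_square)
  finally show "0 \<le> Re (\<Sum>i<n. \<Sum>j<n. cnj (x i) * R $$ (i, j) * x j)"
    using assms(2) by (simp only: Re_complex_of_real) (intro sum_nonneg, auto)
qed

lemma (in sites) state_reduced:
  assumes Y: "Y \<subseteq> V" and X: "X \<subseteq> Y" and R: "state (sys_dim d Y) R"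
  shows "state (sys_dim d X) (reduced_state d Y X R)"
  unfolding state_def
proof (intro conjI allI)
  let ?N = "sys_dim d X" and ?M = "sys_dim d (Y - X)"
  have Rc: "R \<in> carrier_mat (sys_dim d Y) (sys_dim d Y)" "is_hermitian R" "mat_trace R = 1"
    using R by (auto simp: state_def)
  show "is_hermitian (reduced_state d Y X R)" by (rule reduced_state_hermitian[OF Y X Rc(1,2)])
  show "mat_trace (reduced_state d Y X R) = 1" by (simp add: mat_trace_reduced_state[OF Y X Rc(1)] Rc)
  fix x :: "nat \<Rightarrow> complex"
  \<comment> \<open>\<open>y c\<close> is the vector \<open>x \<otimes> e_c\<close>. The quadratic
    form of the marginal at \<open>x\<close> is the sum over \<open>c\<close> of the forms of
    \<open>R\<close> at these vectors.\<close>
  define y where "y c k = (if sub_index d Y (Y - X) k = c then x (sub_index d Y X k) else 0)" for c k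
  have y: "y c (glue Y X a c') = (if c' = c then x a else 0)"
    if "a < ?N" "c' < ?M" for a c c'
    using that by (simp add: y_def sub_index_glue[OF Y X])
  have slice: "(\<Sum>k<sys_dim d Y. \<Sum>l<sys_dim d Y. cnj (y c k) * R $$ (k, l) * y c l)
      = (\<Sum>a<?N. \<Sum>b<?N. cnj (x a) * R $$ (glue Y X a c, glue Y X b c) * x b)" if c: "c < ?M" for c
  proof -
    let ?g = "\<lambda>a e b f. cnj (x a) * R $$ (glue Y X a e, glue Y X b f) * x b"
    have "(\<Sum>k<sys_dim d Y. \<Sum>l<sys_dim d Y. cnj (y c k) * R $$ (k, l) * y c l)
      = (\<Sum>a<?N. \<Sum>e<?M. \<Sum>b<?N. \<Sum>f<?M. if f = c then if e = c then ?g a e b f else 0 else 0)"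
      unfolding sum_index_split[OF Y X] by (intro sum.cong refl) (simp add: y)
    also have "\<dots> = (\<Sum>a<?N. \<Sum>e<?M. if e = c then \<Sum>b<?N. ?g a e b c else 0)"
      using c by (intro sum.cong refl) (simp add: sum.delta)
    finally have "(\<Sum>k<sys_dim d Y. \<Sum>l<sys_dim d Y. cnj (y c k) * R $$ (k, l) * y c l)
      = (\<Sum>a<?N. \<Sum>e<?M. if e = c then \<Sum>b<?N. ?g a e b c else 0)" .
    then show ?thesis using c by (simp add: sum.delta)
  qed
  have "(\<Sum>a<?N. \<Sum>b<?N. cnj (x a) * reduced_state d Y X R $$ (a, b) * x b)
      = (\<Sum>a<?N. \<Sum>b<?N. \<Sum>c<?M. cnj (x a) * R $$ (glue Y X a c, glue Y X b c) * x b)"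
    by (simp add: reduced_state_index[OF Y X] sum_distrib_left sum_distrib_right)
  also have "\<dots> = (\<Sum>a<?N. \<Sum>c<?M. \<Sum>b<?N. cnj (x a) * R $$ (glue Y X a c, glue Y X b c) * x b)"
    by (rule sum.cong[OF refl], rule sum.swap)
  also have "\<dots> = (\<Sum>c<?M. \<Sum>a<?N. \<Sum>b<?N. cnj (x a) * R $$ (glue Y X a c, glue Y X b c) * x b)"
    by (rule sum.swap)
  also have "\<dots> = (\<Sum>c<?M. \<Sum>k<sys_dim d Y. \<Sum>l<sys_dim d Y. cnj (y c k) * R $$ (k, l) * y c l)"
    by (simp add: slice)
  finally have "Re (\<Sum>a<?N. \<Sum>b<?N. cnj (x a) * reduced_state d Y X R $$ (a, b) * x b)
      = (\<Sum>c<?M. Re (\<Sum>k<sys_dim d Y. \<Sum>l<sys_dim d Y. cnj (y c k) * R $$ (k, l) * y c l))"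
    by (simp only: Re_sum)
  also have "\<dots> \<ge> 0"
    using R unfolding state_def by (intro sum_nonneg) blast
  finally show "0 \<le> Re (\<Sum>a<?N. \<Sum>b<?N. cnj (x a) * reduced_state d Y X R $$ (a, b) * x b)" .
qed simp

section \<open>Entropy and cross entropy\<close>

text \<open>Relative entropy is this minus the entropy of \<open>R\<close>. It is linear in
  \<open>R\<close>, so that traces against the Hamiltonian become sums of cross entropies.\<close>

definition cross_entropy :: "complex mat \<Rightarrow> complex mat \<Rightarrow> real" where
  "cross_entropy R T = - Re (mat_trace (R * mat_log2 T))"

lemma von_neumann_entropy_eq_cross: "von_neumann_entropy R = cross_entropy R R"
  by (simp add: von_neumann_entropy_def cross_entropy_def)

lemma cross_entropy_diagonalised:
  assumes "diagonalises n U p R" "diagonalises n V q T"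
  shows "cross_entropy R T = - (\<Sum>i<n. \<Sum>j<n. overlap U V i j * (p i * log 2 (q j)))"
  unfolding cross_entropy_def
    trace_mult_diagonalised[OF assms(1) mat_log2_diagonalises[OF assms(2)]] Re_complex_of_real ..

lemma cross_entropy_same_basis:
  assumes "diagonalises n U p R" "diagonalises n U q T"
  shows "cross_entropy R T = - (\<Sum>i<n. p i * log 2 (q i))"
proof -
  have "(\<Sum>i<n. \<Sum>j<n. overlap U U i j * (p i * log 2 (q j)))
      = (\<Sum>i<n. \<Sum>j<n. if j = i then p i * log 2 (q j) else 0)"
    by (intro sum.cong refl) (auto simp: overlap_self[OF diagonalisesD(1)[OF assms(1)]])
  then show ?thesis by (simp add: cross_entropy_diagonalised[OF assms] sum.delta)
qed

lemma von_neumann_entropy_diagonalised: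
  "diagonalises n U p R \<Longrightarrow> von_neumann_entropy R = - (\<Sum>i<n. p i * log 2 (p i))"
  by (simp add: von_neumann_entropy_eq_cross cross_entropy_same_basis)

lemma sum_overlap_mult:
  assumes "unitary_mat n U" "unitary_mat n V"
  shows "(\<Sum>i<n. \<Sum>j<n. overlap U V i j * f i) = (\<Sum>i<n. f i)"
  by (simp add: sum_distrib_right[symmetric] sum_overlap[OF assms])

lemma relative_entropy_diagonalised:
  assumes "diagonalises n U p R" "diagonalises n V q T"
  shows "cross_entropy R T - von_neumann_entropy R
    = (\<Sum>i<n. \<Sum>j<n. overlap U V i j * (p i * (log 2 (p i) - log 2 (q j))))"
proof -
  have "(\<Sum>i<n. p i * log 2 (p i)) = (\<Sum>i<n. \<Sum>j<n. overlap U V i j * (p i * log 2 (p i)))"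
    by (rule sum_overlap_mult[symmetric]) (use assms in \<open>auto simp: diagonalises_def\<close>)
  then show ?thesis
    unfolding cross_entropy_diagonalised[OF assms] von_neumann_entropy_diagonalised[OF assms(1)]
    by (simp add: right_diff_distrib sum_subtractf)
qed

section \<open>Monotonicity of the relative entropy under partial trace\<close>

lemma tendsto_log_ratio:
  fixes p q :: real
  assumes "0 \<le> p" "0 < q"
  shows "((\<lambda>T. p * (ln (q + T * p) - ln (1 + T) - ln q)) \<longlongrightarrow> p * (ln p - ln q)) at_top"
proof (cases "p = 0")
  case False
  then have "p > 0" using assms by simp
  then have "((\<lambda>T. ln (q + T * p) - ln (1 + T)) \<longlongrightarrow> ln p) at_top"
    using assms(2) by real_asymp
  then show ?thesis by (intro tendsto_intros)
qed simp

text \<open>\<open>F\<close> is the integral of \<open>resolvent_overlap\<close> from 0: it vanishes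
  at 0 and has that derivative. After subtraction of \<open>ln (1 + t)\<close>, the same for both
  pairs, it tends to the relative entropy in natural units. An inequality between derivatives thus
  survives to the limit, and no improper integral is needed.\<close>

lemma relative_entropy_mono_of_resolvent:
  assumes R: "state n R" "diagonalises n U p R" and T: "diagonalises n V q T" "\<And>j. j < n \<Longrightarrow> 0 < q j"
    and R': "state n' R'" "diagonalises n' U' p' R'"
    and T': "diagonalises n' V' q' T'" "\<And>j. j < n' \<Longrightarrow> 0 < q' j"
    and le: "\<And>t. 0 \<le> t \<Longrightarrow> resolvent_overlap n' U' p' V' q' t \<le> resolvent_overlap n U p V q t"
  shows "cross_entropy R' T' - von_neumann_entropy R' \<le> cross_entropy R T - von_neumann_entropy R"
proof -
  define F where "F n U p V q t = (\<Sum>i<n. \<Sum>j<n. overlap U V i j * (p i * (ln (q j + t * p i) - ln (q j))))"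
    for n U V and p q :: "nat \<Rightarrow> real" and t
  have deriv: "(F n U p V q has_real_derivative resolvent_overlap n U p V q t) (at t)"
    if "\<And>i. i < n \<Longrightarrow> 0 \<le> p i" "\<And>j. j < n \<Longrightarrow> 0 < q j" "0 \<le> t" for n U V t and p q :: "nat \<Rightarrow> real"
    unfolding F_def resolvent_overlap_def
  proof (intro DERIV_sum)
    fix i j assume "i \<in> {..<n}" "j \<in> {..<n}"
    then have "0 < q j + t * p i" using that by (simp add: add_pos_nonneg)
    then show "((\<lambda>t. overlap U V i j * (p i * (ln (q j + t * p i) - ln (q j)))) has_real_derivative
        overlap U V i j * ((p i)\<^sup>2 / (q j + t * p i))) (at t)"
      by (auto intro!: derivative_eq_intros simp: power2_eq_square)
  qed
  have lim: "((\<lambda>t. F n U p V q t - ln (1 + t)) \<longlongrightarrow>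
      ln 2 * (cross_entropy R T - von_neumann_entropy R)) at_top"
    if "state n R" "diagonalises n U p R" "diagonalises n V q T" "\<And>j. j < n \<Longrightarrow> 0 < q j"
    for n R U p V q T
  proof -
    note nonneg = state_diagonalised[OF that(1,2)]
    note uv = diagonalisesD(1)[OF that(2)] diagonalisesD(1)[OF that(3)]
    \<comment> \<open>The weights \<open>overlap U V i j * p i\<close> sum to one because
      \<open>R\<close> has trace one. This spreads \<open>ln (1 + t)\<close> over the terms so that
      each converges by itself.\<close>
    have ln: "ln (1 + t) = (\<Sum>i<n. \<Sum>j<n. overlap U V i j * (p i * ln (1 + t)))" for t
      unfolding sum_overlap_mult[OF uv] using nonneg(2) by (simp add: sum_distrib_right[symmetric])
    have "F n U p V q t - ln (1 + t) = (\<Sum>i<n. \<Sum>j<n. overlap U V i j *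
        (p i * (ln (q j + t * p i) - ln (1 + t) - ln (q j))))" for t
      unfolding F_def by (subst ln, unfold sum_subtractf[symmetric], intro sum.cong refl)
        (simp add: algebra_simps)
    moreover have "((\<lambda>t. \<Sum>i<n. \<Sum>j<n. overlap U V i j *
        (p i * (ln (q j + t * p i) - ln (1 + t) - ln (q j)))) \<longlongrightarrow>
        (\<Sum>i<n. \<Sum>j<n. overlap U V i j * (p i * (ln (p i) - ln (q j))))) at_top"
      by (intro tendsto_sum tendsto_mult_left tendsto_log_ratio) (use nonneg that(4) in auto)
    moreover have "(\<Sum>i<n. \<Sum>j<n. overlap U V i j * (p i * (ln (p i) - ln (q j))))
        = ln 2 * (cross_entropy R T - von_neumann_entropy R)"
      unfolding relative_entropy_diagonalised[OF that(2,3)]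
      unfolding sum_distrib_left by (intro sum.cong refl) (simp add: log_def field_simps)
    ultimately show ?thesis by simp
  qed
  have "F n' U' p' V' q' t - ln (1 + t) \<le> F n U p V q t - ln (1 + t)" if t: "0 \<le> t" for t
  proof -
    let ?h = "\<lambda>t. F n U p V q t - F n' U' p' V' q' t"
    have "?h 0 \<le> ?h t"
    proof (rule DERIV_nonneg_imp_nondecreasing[OF t])
      fix s :: real assume "0 \<le> s" "s \<le> t"
      then have "(?h has_real_derivative
          resolvent_overlap n U p V q s - resolvent_overlap n' U' p' V' q' s) (at s)"
        using state_diagonalised(1)[OF R] state_diagonalised(1)[OF R'] T(2) T'(2)
        by (intro DERIV_diff deriv) auto
      then show "\<exists>y. (?h has_real_derivative y) (at s) \<and> 0 \<le> y"
        using le[OF \<open>0 \<le> s\<close>] by (intro exI conjI) auto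
    qed
    then show ?thesis by (simp add: F_def)
  qed
  then have "\<forall>\<^sub>F t in at_top. F n' U' p' V' q' t - ln (1 + t) \<le> F n U p V q t - ln (1 + t)"
    by (intro eventually_at_top_linorderI[of 0])
  then have "ln 2 * (cross_entropy R' T' - von_neumann_entropy R')
      \<le> ln 2 * (cross_entropy R T - von_neumann_entropy R)"
    using tendsto_le[OF trivial_limit_at_top_linorder lim[OF R T] lim[OF R' T']] by simp
  then show ?thesis by (simp add: mult_le_cancel_left_pos)
qed

context sites
begin

text \<open>All three terms are traces of \<open>R\<close> or \<open>T\<close> against an extended
  operator, so the duality of \<open>trace_extend_op\<close> applies to each.\<close>

lemma variational_form_extend_op:
  assumes Y: "Y \<subseteq> V" and X: "X \<subseteq> Y"
    and R: "R \<in> carrier_mat (sys_dim d Y) (sys_dim d Y)" and T: "T \<in> carrier_mat (sys_dim d Y) (sys_dim d Y)"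
    and A: "A \<in> carrier_mat (sys_dim d X) (sys_dim d X)"
  shows "variational_form R T t (extend_op d Y X A)
    = variational_form (reduced_state d Y X R) (reduced_state d Y X T) t A"
proof -
  let ?n = "sys_dim d Y" and ?k = "sys_dim d X" and ?E = "extend_op d Y X"
    and ?r = "reduced_state d Y X"
  have V: "X \<subseteq> V" using X Y by auto
  note ext = extend_op_mult[OF Y X, symmetric] extend_op_adjoint[OF V, symmetric]
  have 1: "mat_trace (?E (mat_adjoint A) * R) = mat_trace (mat_adjoint A * ?r R)"
    using R A trace_extend_op[OF Y X R, of "mat_adjoint A"] mat_trace_mult_comm[of "?E (mat_adjoint A)" ?n ?n R]
      mat_trace_mult_comm[of "mat_adjoint A" ?k ?k "?r R"] by simp
  \<comment> \<open>Cyclicity moves both extended operators to the same side of \<open>S\<close>,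
    where their product is again an extension.\<close>
  have 2: "mat_trace (?E B * (S * ?E C)) = mat_trace (B * (?r S * C))"
    if "S \<in> carrier_mat ?n ?n" "B \<in> carrier_mat ?k ?k" "C \<in> carrier_mat ?k ?k" for S B C
  proof -
    have "mat_trace (?E B * (S * ?E C)) = mat_trace ((S * ?E C) * ?E B)"
      by (rule mat_trace_mult_comm[of _ ?n ?n]) (use that in auto)
    also have "(S * ?E C) * ?E B = S * ?E (C * B)"
      using that by (simp add: assoc_mult_mat[of _ ?n ?n _ ?n _ ?n] ext)
    also have "mat_trace \<dots> = mat_trace (?r S * (C * B))"
      by (rule trace_extend_op[OF Y X]) (use that in auto)
    also have "\<dots> = mat_trace ((?r S * C) * B)"
      using that by (simp add: assoc_mult_mat[of _ ?k ?k _ ?k _ ?k])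
    also have "\<dots> = mat_trace (B * (?r S * C))"
      by (rule mat_trace_mult_comm[of _ ?k ?k]) (use that in auto)
    finally show ?thesis .
  qed
  show ?thesis
    unfolding variational_form_def extend_op_adjoint[OF V A, symmetric]
    using A R T by (simp only: 1 2 mat_adjoint_carrier)
qed

text \<open>The maximiser for the marginals, extended by the identity, is a competitor for the full
  pair with the same value. \<open>T\<close> need not be normalised.\<close>

theorem relative_entropy_reduced_le:
  assumes Y: "Y \<subseteq> V" and X: "X \<subseteq> Y" and R: "state (sys_dim d Y) R"
    and T: "diagonalises (sys_dim d Y) W q T" "\<And>j. j < sys_dim d Y \<Longrightarrow> 0 < q j"
    and TX: "diagonalises (sys_dim d X) W' q' (reduced_state d Y X T)"
      "\<And>j. j < sys_dim d X \<Longrightarrow> 0 < q' j"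
  shows "cross_entropy (reduced_state d Y X R) (reduced_state d Y X T)
      - von_neumann_entropy (reduced_state d Y X R) \<le> cross_entropy R T - von_neumann_entropy R"
proof -
  have RX: "state (sys_dim d X) (reduced_state d Y X R)" by (rule state_reduced[OF Y X R])
  obtain U p where Up: "diagonalises (sys_dim d Y) U p R"
    using hermitian_diagonalises R unfolding state_def by blast
  obtain U' p' where Up': "diagonalises (sys_dim d X) U' p' (reduced_state d Y X R)"
    using hermitian_diagonalises RX unfolding state_def by blast
  show ?thesis
  proof (rule relative_entropy_mono_of_resolvent[OF R Up T RX Up' TX])
    fix t :: real assume t: "0 \<le> t"
    obtain A where A: "A \<in> carrier_mat (sys_dim d X) (sys_dim d X)"
      "variational_form (reduced_state d Y X R) (reduced_state d Y X T) t A
        = resolvent_overlap (sys_dim d X) U' p' W' q' t"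
      using variational_form_attained[OF Up' TX(1) state_diagonalised(1)[OF RX Up'] TX(2) t] by blast
    have "variational_form R T t (extend_op d Y X A) \<le> resolvent_overlap (sys_dim d Y) U p W q t"
      by (rule variational_form_le[OF Up T(1) _ state_diagonalised(1)[OF R Up] T(2) t]) auto
    then show "resolvent_overlap (sys_dim d X) U' p' W' q' t \<le> resolvent_overlap (sys_dim d Y) U p W q t"
      using variational_form_extend_op[OF Y X diagonalisesD(3)[OF Up] diagonalisesD(3)[OF T(1)] A(1)] A(2)
      by simp
  qed auto
qed

end

section \<open>Depolarised states\<close>

text \<open>The mixture of \<open>R\<close> with the maximally mixed state. It keeps the eigenbasis
  of \<open>R\<close>, and for a state and \<open>0 < t \<le> 1\<close> it is invertible.\<close>

definition depolarise :: "nat \<Rightarrow> real \<Rightarrow> complex mat \<Rightarrow> complex mat" where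
  "depolarise n t R = mat n n (\<lambda>(i, j). of_real (1 - t) * R $$ (i, j)
     + (if i = j then of_real (t / real n) else 0))"

lemma depolarise_carrier [simp]: "depolarise n t R \<in> carrier_mat n n"
  by (simp add: depolarise_def)

lemma depolarise_diagonalises:
  assumes "diagonalises n U p R"
  shows "diagonalises n U (\<lambda>i. (1 - t) * p i + t / real n) (depolarise n t R)"
proof (rule diagonalisesI)
  note u = diagonalisesD[OF assms]
  show "unitary_mat n U" by (rule u)
  fix i j assume ij: "i < n" "j < n"
  have "(\<Sum>k<n. complex_of_real ((1 - t) * p k + t / real n) * (U $$ (i, k) * cnj (U $$ (j, k))))
      = of_real (1 - t) * (\<Sum>k<n. of_real (p k) * (U $$ (i, k) * cnj (U $$ (j, k))))
        + of_real (t / real n) * (\<Sum>k<n. U $$ (i, k) * cnj (U $$ (j, k)))"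
    unfolding sum_distrib_left sum.distrib[symmetric]
    by (intro sum.cong refl) (simp add: algebra_simps)
  then show "depolarise n t R $$ (i, j)
      = (\<Sum>k<n. complex_of_real ((1 - t) * p k + t / real n) * (U $$ (i, k) * cnj (U $$ (j, k))))"
    using ij by (simp add: u(4) unitary_sum(2)[OF u(1)] depolarise_def)
qed simp

lemma state_dim_pos: "state n R \<Longrightarrow> 0 < n"
  by (cases n) (auto simp: state_def mat_trace_def)

lemma depolarise_state:
  assumes "state n R" "0 \<le> t" "t \<le> 1"
  shows "state n (depolarise n t R)"
proof -
  obtain U p where Up: "diagonalises n U p R"
    using hermitian_diagonalises assms(1) unfolding state_def by blast
  note p = state_diagonalised[OF assms(1) Up]
  show ?thesis
  proof (rule diagonalised_state[OF depolarise_diagonalises[OF Up]])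
    show "0 \<le> (1 - t) * p i + t / real n" if "i < n" for i
      using p(1)[OF that] assms by simp
    show "(\<Sum>i<n. (1 - t) * p i + t / real n) = 1"
      using p(2) state_dim_pos[OF assms(1)] by (simp add: sum.distrib sum_distrib_left[symmetric])
  qed
qed

lemma depolarise_positive:
  assumes "state n R" "0 < t" "t \<le> 1"
  shows "\<exists>U q. diagonalises n U q (depolarise n t R) \<and> (\<forall>i<n. 0 < q i)"
proof -
  obtain U p where Up: "diagonalises n U p R"
    using hermitian_diagonalises assms(1) unfolding state_def by blast
  have "0 < (1 - t) * p i + t / real n" if "i < n" for i
    using state_diagonalised(1)[OF assms(1) Up that] assms(2,3) that
    by (intro add_nonneg_pos) auto
  then show ?thesis using depolarise_diagonalises[OF Up] by blast
qed

text \<open>Each diagonal entry collects \<open>t / sys_dim d Y\<close> once for every index on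
  \<open>Y - X\<close>, which gives \<open>t / sys_dim d X\<close>. The depolarised marginals are
  therefore the marginals of one depolarised state.\<close>

lemma (in sites) reduced_state_depolarise:
  assumes Y: "Y \<subseteq> V" and X: "X \<subseteq> Y"
  shows "reduced_state d Y X (depolarise (sys_dim d Y) t R)
    = depolarise (sys_dim d X) t (reduced_state d Y X R)"
proof (rule eq_matI)
  let ?N = "sys_dim d X" and ?M = "sys_dim d (Y - X)"
  fix a b assume "a < dim_row (depolarise ?N t (reduced_state d Y X R))"
    "b < dim_col (depolarise ?N t (reduced_state d Y X R))"
  then have ab: "a < ?N" "b < ?N" by (auto simp: depolarise_def)
  have fin: "finite X" "finite (Y - X)" using X Y by (auto intro: finite_sub)
  have dim: "sys_dim d Y = ?N * ?M"
    unfolding sys_dim_def using X fin by (subst prod.union_disjoint[symmetric]) (auto simp: Un_absorb1)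
  have M: "0 < ?M" "0 < ?N" using Y X by (auto intro!: sys_dim_pos)
  have "glue Y X a c = glue Y X b c \<longleftrightarrow> a = b" if "c < ?M" for c
    using sub_index_glue(1)[OF Y X] ab by metis
  then have "reduced_state d Y X (depolarise (sys_dim d Y) t R) $$ (a, b)
    = (\<Sum>c<?M. of_real (1 - t) * R $$ (glue Y X a c, glue Y X b c)
        + (if a = b then of_real (t / real (sys_dim d Y)) else 0))"
    unfolding reduced_state_index[OF Y X ab]
    by (intro sum.cong refl) (simp add: depolarise_def glue_less[OF Y])
  also have "\<dots> = depolarise ?N t (reduced_state d Y X R) $$ (a, b)"
    using ab M by (simp add: depolarise_def reduced_state_index[OF Y X] sum.distrib
        sum_distrib_left dim)
  finally show "reduced_state d Y X (depolarise (sys_dim d Y) t R) $$ (a, b)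
    = depolarise ?N t (reduced_state d Y X R) $$ (a, b)" .
qed (auto simp: depolarise_def reduced_state_def)

text \<open>The logarithm is discontinuous at 0, so \<open>p = 0\<close> is separate: the first
  limit is then that of \<open>x log x\<close>, and in the second the factor \<open>p\<close> makes
  the function constantly 0.\<close>

lemma tendsto_entropy_term:
  fixes p :: real and n :: nat
  assumes "0 \<le> p" "0 < n"
  shows "((\<lambda>t. ((1 - t) * p + t / real n) * log 2 ((1 - t) * p + t / real n)) \<longlongrightarrow> p * log 2 p) (at_right 0)"
    and "((\<lambda>t. p * log 2 ((1 - t) * p + t / real n)) \<longlongrightarrow> p * log 2 p) (at_right 0)"
proof -
  have lim: "((\<lambda>t. (1 - t) * p + t / real n) \<longlongrightarrow> p) (at_right 0)"
    by (rule tendsto_eq_rhs, (rule tendsto_intros | use assms in simp)+)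
  have pos: "((\<lambda>t. log 2 ((1 - t) * p + t / real n)) \<longlongrightarrow> log 2 p) (at_right 0)" if "p \<noteq> 0"
    by (rule tendsto_log[OF tendsto_const lim]) (use that assms in auto)
  show "((\<lambda>t. p * log 2 ((1 - t) * p + t / real n)) \<longlongrightarrow> p * log 2 p) (at_right 0)"
    using pos by (cases "p = 0") (auto intro: tendsto_mult_left)
  show "((\<lambda>t. ((1 - t) * p + t / real n) * log 2 ((1 - t) * p + t / real n)) \<longlongrightarrow> p * log 2 p) (at_right 0)"
  proof (cases "p = 0")
    case True
    have "real n > 0" using assms by simp
    then have "((\<lambda>t. t / real n * log 2 (t / real n)) \<longlongrightarrow> 0) (at_right 0)" by real_asymp
    then show ?thesis by (simp add: True)
  next
    case False
    then show ?thesis using tendsto_mult[OF lim pos] by simp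
  qed
qed

lemma tendsto_entropy_depolarise:
  assumes "state n R"
  shows "((\<lambda>t. von_neumann_entropy (depolarise n t R)) \<longlongrightarrow> von_neumann_entropy R) (at_right 0)"
    and "((\<lambda>t. cross_entropy R (depolarise n t R)) \<longlongrightarrow> von_neumann_entropy R) (at_right 0)"
proof -
  obtain U p where Up: "diagonalises n U p R"
    using hermitian_diagonalises assms(1) unfolding state_def by blast
  note p = state_diagonalised[OF assms(1) Up]
  note dep = depolarise_diagonalises[OF Up]
  show "((\<lambda>t. von_neumann_entropy (depolarise n t R)) \<longlongrightarrow> von_neumann_entropy R) (at_right 0)"
    unfolding von_neumann_entropy_diagonalised[OF Up] von_neumann_entropy_diagonalised[OF dep]
    by (intro tendsto_minus tendsto_sum tendsto_entropy_term) (use p state_dim_pos[OF assms] in auto)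
  show "((\<lambda>t. cross_entropy R (depolarise n t R)) \<longlongrightarrow> von_neumann_entropy R) (at_right 0)"
    unfolding von_neumann_entropy_diagonalised[OF Up] cross_entropy_same_basis[OF Up dep]
    by (intro tendsto_minus tendsto_sum tendsto_entropy_term) (use p state_dim_pos[OF assms] in auto)
qed

section \<open>Strong subadditivity\<close>

context sites
begin

lemma mat_log2_extend_op:
  assumes "Y \<subseteq> V" "X \<subseteq> Y" "diagonalises (sys_dim d X) U e A"
  shows "mat_log2 (extend_op d Y X A) = extend_op d Y X (mat_log2 A)"
  using mat_log2_diagonalises[OF extend_op_diagonalises[OF assms]]
    extend_op_diagonalises[OF assms(1,2) mat_log2_diagonalises[OF assms(3)]]
  by (simp add: diagonalises_def)

lemma cross_entropy_extend_op:
  assumes Y: "Y \<subseteq> V" and X: "X \<subseteq> Y" and T: "diagonalises (sys_dim d X) U e T"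
    and R: "R \<in> carrier_mat (sys_dim d Y) (sys_dim d Y)"
  shows "cross_entropy R (extend_op d Y X T) = cross_entropy (reduced_state d Y X R) T"
  using diagonalisesD(3)[OF mat_log2_diagonalises[OF T]]
  by (simp add: cross_entropy_def mat_log2_extend_op[OF Y X T] trace_extend_op[OF Y X R])

text \<open>Monotonicity applied to the pair of \<open>R\<close> and \<open>1 \<otimes> R_B\<close>:
  its relative entropy is S(B) - S(AB), and after restriction to \<open>A\<close> it becomes S(C) -
  S(A), where C is the intersection.\<close>

lemma entropy_union_inter_le_positive:
  assumes A: "A \<subseteq> V" and B: "B \<subseteq> V" and R: "state (sys_dim d (A \<union> B)) R"
    and pos: "\<And>X. X \<subseteq> A \<union> B \<Longrightarrow>
      \<exists>U q. diagonalises (sys_dim d X) U q (reduced_state d (A \<union> B) X R) \<and> (\<forall>i<sys_dim d X. 0 < q i)"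
  shows "von_neumann_entropy R + entropy d (A \<union> B) R (A \<inter> B)
    \<le> entropy d (A \<union> B) R A + entropy d (A \<union> B) R B"
proof -
  let ?Y = "A \<union> B" and ?C = "A \<inter> B"
  let ?R = "\<lambda>X. reduced_state d ?Y X R"
  have Y: "?Y \<subseteq> V" and sub: "A \<subseteq> ?Y" "B \<subseteq> ?Y" "?C \<subseteq> ?Y" "?C \<subseteq> A" "?C \<subseteq> B"
    and C: "?C \<subseteq> V" using A B by auto
  have Rc: "R \<in> carrier_mat (sys_dim d ?Y) (sys_dim d ?Y)" using R by (simp add: state_def)
  obtain U q where Uq: "diagonalises (sys_dim d B) U q (?R B)" "\<And>i. i < sys_dim d B \<Longrightarrow> 0 < q i"
    using pos[OF sub(2)] by blast
  obtain W r where Wr: "diagonalises (sys_dim d ?C) W r (?R ?C)" "\<And>i. i < sys_dim d ?C \<Longrightarrow> 0 < r i"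
    using pos[OF sub(3)] by blast
  \<comment> \<open>Using the plain identity instead of a maximally mixed state keeps logarithms of
    dimensions out of the formulas.\<close>
  define T where "T = extend_op d ?Y B (?R B)"
  have TA: "reduced_state d ?Y A T = extend_op d A ?C (?R ?C)"
    unfolding T_def
    by (simp add: reduced_state_extend_op[OF A B] reduced_state_trans[OF Y sub(2) sub(5) Rc])
  have "cross_entropy (?R A) (reduced_state d ?Y A T) - von_neumann_entropy (?R A)
      \<le> cross_entropy R T - von_neumann_entropy R"
  proof (rule relative_entropy_reduced_le[OF Y sub(1) R])
    show "diagonalises (sys_dim d ?Y) (extend_op d ?Y B U) (\<lambda>k. q (sub_index d ?Y B k)) T"
      unfolding T_def by (rule extend_op_diagonalises[OF Y sub(2) Uq(1)])
    show "diagonalises (sys_dim d A) (extend_op d A ?C W) (\<lambda>k. r (sub_index d A ?C k))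
        (reduced_state d ?Y A T)"
      unfolding TA by (rule extend_op_diagonalises[OF A sub(4) Wr(1)])
  qed (use Uq(2) Wr(2) sub_index_less[OF B] sub_index_less[OF C] in auto)
  moreover have "cross_entropy R T = cross_entropy (?R B) (?R B)"
    unfolding T_def by (rule cross_entropy_extend_op[OF Y sub(2) Uq(1) Rc])
  moreover have "cross_entropy (?R A) (reduced_state d ?Y A T) = cross_entropy (?R ?C) (?R ?C)"
    unfolding TA
    using cross_entropy_extend_op[OF A sub(4) Wr(1) reduced_state_carrier[of d ?Y A R]]
    by (simp add: reduced_state_trans[OF Y sub(1) sub(4) Rc])
  ultimately show ?thesis by (simp add: entropy_def von_neumann_entropy_eq_cross)
qed

text \<open>The invertible case holds for the depolarised marginal on \<open>A \<union> B\<close>,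
  whose own marginals are the depolarised ones of \<open>R\<close>; letting \<open>t\<close> tend to
  0 from the right removes the perturbation.\<close>

theorem strong_subadditivity:
  assumes Y: "Y \<subseteq> V" and R: "state (sys_dim d Y) R" and A: "A \<subseteq> Y" and B: "B \<subseteq> Y"
  shows "entropy d Y R (A \<union> B) + entropy d Y R (A \<inter> B) \<le> entropy d Y R A + entropy d Y R B"
proof -
  let ?Z = "A \<union> B" and ?R = "\<lambda>X. reduced_state d Y X R"
  have Z: "?Z \<subseteq> Y" "?Z \<subseteq> V" "A \<subseteq> V" "B \<subseteq> V" using A B Y by auto
  have Rc: "R \<in> carrier_mat (sys_dim d Y) (sys_dim d Y)" using R by (simp add: state_def)
  have st: "state (sys_dim d X) (?R X)" if "X \<subseteq> Y" for X by (rule state_reduced[OF Y that R])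
  define S where "S X t = von_neumann_entropy (depolarise (sys_dim d X) t (?R X))" for X t
  have lim: "(S X \<longlongrightarrow> entropy d Y R X) (at_right 0)" if "X \<subseteq> Y" for X
    unfolding S_def entropy_def by (rule tendsto_entropy_depolarise(1)[OF st[OF that]])
  have ineq: "S ?Z t + S (A \<inter> B) t \<le> S A t + S B t" if t: "0 < t" "t \<le> 1" for t
  proof -
    let ?D = "depolarise (sys_dim d ?Z) t (?R ?Z)"
    have D: "reduced_state d ?Z X ?D = depolarise (sys_dim d X) t (?R X)" if "X \<subseteq> ?Z" for X
      by (simp add: reduced_state_depolarise[OF Z(2) that] reduced_state_trans[OF Y Z(1) that Rc])
    have "von_neumann_entropy ?D + entropy d ?Z ?D (A \<inter> B) \<le> entropy d ?Z ?D A + entropy d ?Z ?D B"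
    proof (rule entropy_union_inter_le_positive[OF Z(3,4)])
      show "state (sys_dim d ?Z) ?D" using t st[OF Z(1)] by (intro depolarise_state) auto
      show "\<exists>U q. diagonalises (sys_dim d X) U q (reduced_state d ?Z X ?D) \<and> (\<forall>i<sys_dim d X. 0 < q i)"
        if "X \<subseteq> ?Z" for X
        unfolding D[OF that] using that Z(1) by (intro depolarise_positive[OF st t]) auto
    qed
    then show ?thesis by (simp add: entropy_def D S_def le_infI1)
  qed
  have "\<forall>\<^sub>F t in at_right 0. S ?Z t + S (A \<inter> B) t \<le> S A t + S B t"
  proof -
    have "\<forall>\<^sub>F t in at_right 0. t \<in> {0<..<1::real}" by (rule eventually_at_right_real) simp
    then show ?thesis by eventually_elim (auto intro: ineq)
  qed
  then show ?thesis
    using tendsto_le[OF trivial_limit_at_right_real tendsto_add[OF lim[OF A] lim[OF B]]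
        tendsto_add[OF lim[OF Z(1)] lim[of "A \<inter> B"]]] A by auto
qed

lemma entropy_empty:
  assumes "Y \<subseteq> V" "state (sys_dim d Y) R"
  shows "entropy d Y R {} = 0"
proof -
  have st: "state 1 (reduced_state d Y {} R)" using state_reduced[OF assms(1) _ assms(2), of "{}"] by simp
  then obtain U p where Up: "diagonalises 1 U p (reduced_state d Y {} R)"
    using hermitian_diagonalises unfolding state_def by blast
  show ?thesis
    using von_neumann_entropy_diagonalised[OF Up] state_diagonalised(2)[OF st Up]
    by (simp add: entropy_def)
qed

end

section \<open>Gibbs states\<close>

lemma diagonalises_mult:
  assumes "diagonalises n U e A" "diagonalises n U f B"
  shows "diagonalises n U (\<lambda>i. e i * f i) (A * B)"
proof -
  note U = diagonalisesD(1)[OF assms(1)]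
  note u = unitary_matD[OF U]
  have "real_diag_mat n e * real_diag_mat n f = real_diag_mat n (\<lambda>i. e i * f i)"
    by (rule eq_matI)
      (simp_all add: real_diag_mult_index[of _ n n] del: index_mult_mat(1), simp add: real_diag_mat_def)
  moreover have "A * B = U * (real_diag_mat n e * real_diag_mat n f) * mat_adjoint U"
    using assms u by (simp add: diagonalises_def assoc_mult_mat[of _ n n _ n _ n] unitary_cancel[OF U])
  ultimately show ?thesis using U by (simp add: diagonalises_def)
qed

lemma diagonalises_one:
  assumes "unitary_mat n U"
  shows "diagonalises n U (\<lambda>_. 1) (1\<^sub>m n)"
  by (rule diagonalisesI[OF assms]) (auto simp: unitary_sum(2)[OF assms])

lemma diagonalises_scaled:
  assumes "diagonalises n U e A"
  shows "diagonalises n U (\<lambda>i. c * e i) (complex_of_real c \<cdot>\<^sub>m A)"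
proof (rule diagonalisesI)
  note a = diagonalisesD[OF assms]
  show "unitary_mat n U" "complex_of_real c \<cdot>\<^sub>m A \<in> carrier_mat n n" using a by auto
  fix i j assume "i < n" "j < n"
  then show "(complex_of_real c \<cdot>\<^sub>m A) $$ (i, j)
      = (\<Sum>k<n. complex_of_real (c * e k) * (U $$ (i, k) * cnj (U $$ (j, k))))"
    using a(3) by (simp add: a(4) sum_distrib_left mult.assoc)
qed

text \<open>All powers share the eigenbasis, so the entrywise series is a finite combination of
  scalar exponential series.\<close>

lemma mat_exp_diagonalises:
  assumes "diagonalises n U e A"
  shows "diagonalises n U (\<lambda>i. exp (e i)) (mat_exp A)"
proof (rule diagonalisesI)
  note a = diagonalisesD[OF assms]
  have n: "dim_row A = n" using a by auto
  show "unitary_mat n U" "mat_exp A \<in> carrier_mat n n" using a by (auto simp: mat_exp_def)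
  have pow: "diagonalises n U (\<lambda>i. e i ^ k) (A ^\<^sub>m k)" for k
  proof (induction k)
    case 0
    then show ?case using diagonalises_one[OF a(1)] n by simp
  next
    case (Suc k)
    then show ?case using diagonalises_mult[OF Suc assms] by (simp add: mult.commute)
  qed
  fix i j assume ij: "i < n" "j < n"
  define c where "c l = U $$ (i, l) * cnj (U $$ (j, l))" for l
  have "(\<lambda>k. \<Sum>l<n. complex_of_real (e l) ^ k / fact k * c l) sums (\<Sum>l<n. exp (complex_of_real (e l)) * c l)"
  proof (intro sums_sum sums_mult2)
    show "(\<lambda>k. complex_of_real (e l) ^ k / fact k) sums exp (complex_of_real (e l))" for l
      using exp_converges[of "complex_of_real (e l)"]
      by (simp add: scaleR_conv_of_real divide_inverse mult.commute)
  qed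
  then have "(\<Sum>k. \<Sum>l<n. complex_of_real (e l) ^ k / fact k * c l) = (\<Sum>l<n. exp (complex_of_real (e l)) * c l)"
    by (rule sums_unique[symmetric])
  moreover have "(A ^\<^sub>m k) $$ (i, j) / fact k = (\<Sum>l<n. complex_of_real (e l) ^ k / fact k * c l)" for k
    using diagonalisesD(4)[OF pow[of k] ij] by (simp add: sum_divide_distrib c_def)
  ultimately show "mat_exp A $$ (i, j)
      = (\<Sum>k<n. complex_of_real (exp (e k)) * (U $$ (i, k) * cnj (U $$ (j, k))))"
    using ij n by (simp add: mat_exp_def c_def exp_of_real)
qed

lemma gibbs_state_diagonalises:
  assumes "diagonalises n U e H"
  shows "diagonalises n U (\<lambda>i. exp (- e i) / (\<Sum>i<n. exp (- e i))) (gibbs_state H)"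
proof -
  have "diagonalises n U (\<lambda>i. - 1 * e i) (complex_of_real (- 1) \<cdot>\<^sub>m H)"
    by (rule diagonalises_scaled[OF assms])
  moreover have "complex_of_real (- 1) \<cdot>\<^sub>m H = - H" by (rule eq_matI) auto
  ultimately have "diagonalises n U (\<lambda>i. - e i) (- H)" by simp
  from mat_exp_diagonalises[OF this]
  have ex: "diagonalises n U (\<lambda>i. exp (- e i)) (mat_exp (- H))" .
  have "gibbs_state H = complex_of_real (inverse (\<Sum>i<n. exp (- e i))) \<cdot>\<^sub>m mat_exp (- H)"
    by (simp add: gibbs_state_def trace_diagonalised[OF ex])
  then show ?thesis
    using diagonalises_scaled[OF ex, of "inverse (\<Sum>i<n. exp (- e i))"]
    by (simp only: divide_inverse mult.commute)
qed

text \<open>A positive definite \<open>T\<close> has the inverse \<open>herm_fun inverse T\<close>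
  and hence full range. Relative entropy to a Gibbs state is thus never infinite.\<close>

lemma mat_range_positive:
  assumes T: "diagonalises n U q T" "\<And>i. i < n \<Longrightarrow> 0 < q i" and R: "R \<in> carrier_mat n n"
  shows "mat_range R \<subseteq> mat_range T"
proof
  fix w assume "w \<in> mat_range R"
  then have w: "w \<in> carrier_vec n" using R by (auto simp: mat_range_def)
  note a = diagonalisesD[OF T(1)]
  have inv: "diagonalises n U (\<lambda>i. inverse (q i)) (herm_fun inverse T)"
    by (rule herm_fun_diagonalises[OF T(1)])
  note b = diagonalisesD[OF inv]
  have one: "T * herm_fun inverse T = 1\<^sub>m n"
  proof (rule eq_matI)
    fix i j assume "i < dim_row (1\<^sub>m n :: complex mat)" "j < dim_col (1\<^sub>m n :: complex mat)"
    then have ij: "i < n" "j < n" by auto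
    have "(T * herm_fun inverse T) $$ (i, j)
        = (\<Sum>k<n. complex_of_real (q k * inverse (q k)) * (U $$ (i, k) * cnj (U $$ (j, k))))"
      by (rule diagonalisesD(4)[OF diagonalises_mult[OF T(1) inv] ij])
    also have "\<dots> = (\<Sum>k<n. U $$ (i, k) * cnj (U $$ (j, k)))"
      using T(2) by (intro sum.cong refl) (metis less_irrefl lessThan_iff mult_1 of_real_1 right_inverse)
    finally show "(T * herm_fun inverse T) $$ (i, j) = (1\<^sub>m n :: complex mat) $$ (i, j)"
      using ij by (simp add: unitary_sum(2)[OF a(1)] del: index_mult_mat(1))
  qed (use a b in auto)
  have "w = (T * herm_fun inverse T) *\<^sub>v w" using w by (simp add: one)
  also have "\<dots> = T *\<^sub>v (herm_fun inverse T *\<^sub>v w)" by (rule assoc_mult_mat_vec[of _ n n _ n]) (use a b w in auto)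
  finally have "w = T *\<^sub>v (herm_fun inverse T *\<^sub>v w)" .
  moreover have "herm_fun inverse T *\<^sub>v w \<in> carrier_vec (dim_col T)"
    using mult_mat_vec_carrier[OF b(3) w] a(3) by simp
  ultimately show "w \<in> mat_range T" unfolding mat_range_def by blast
qed

lemma relative_entropy_eq_cross:
  assumes R: "state n R" and T: "diagonalises n U q T" "\<And>i. i < n \<Longrightarrow> 0 < q i"
  shows "relative_entropy R T = ereal (cross_entropy R T - von_neumann_entropy R)"
proof -
  have Rc: "R \<in> carrier_mat n n" and "is_hermitian R" using R by (auto simp: state_def)
  then obtain V p where "diagonalises n V p R" using hermitian_diagonalises by blast
  then have logs: "mat_log2 R \<in> carrier_mat n n" "mat_log2 T \<in> carrier_mat n n"
    using diagonalisesD(3)[OF mat_log2_diagonalises] T(1) by blast+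
  then have "mat_trace (R * (mat_log2 R - mat_log2 T))
      = mat_trace (R * mat_log2 R) - mat_trace (R * mat_log2 T)"
    using Rc by (simp add: mult_minus_distrib_mat[of _ n n] mat_trace_minus[of _ n])
  then show ?thesis
    using mat_range_positive[OF T Rc]
    by (simp add: relative_entropy_def cross_entropy_def von_neumann_entropy_def)
qed

text \<open>By \<open>log \<sigma> = - H / ln 2 - log Z\<close> both the relative entropy and the entropy of \<open>\<sigma>\<close> involve
  \<open>log Z\<close>, which cancels.\<close>

lemma gibbs_state_relative_entropy:
  assumes R: "state n R" and H: "H \<in> carrier_mat n n" "is_hermitian H"
  defines "\<sigma> \<equiv> gibbs_state H"
  shows "state n \<sigma>"
    and "relative_entropy R \<sigma> = ereal ((Re (mat_trace (R * H)) - Re (mat_trace (\<sigma> * H))) / ln 2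
      + von_neumann_entropy \<sigma> - von_neumann_entropy R)"
proof -
  obtain U e where Ue: "diagonalises n U e H" using hermitian_diagonalises[OF H] by blast
  define Z where "Z = (\<Sum>i<n. exp (- e i))"
  have n: "n > 0" by (rule state_dim_pos[OF R])
  have Z: "Z > 0" unfolding Z_def by (rule sum_pos) (use n in auto)
  have \<sigma>: "diagonalises n U (\<lambda>i. exp (- e i) / Z) \<sigma>"
    unfolding \<sigma>_def Z_def by (rule gibbs_state_diagonalises[OF Ue])
  show st: "state n \<sigma>"
    using Z by (intro diagonalised_state[OF \<sigma>]) (auto simp: Z_def sum_divide_distrib[symmetric])
  have cross: "cross_entropy S \<sigma> = Re (mat_trace (S * H)) / ln 2 + log 2 Z" if S: "state n S" for S
  proof -
    obtain V p where Vp: "diagonalises n V p S"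
      using hermitian_diagonalises S unfolding state_def by blast
    note uv = diagonalisesD(1)[OF Vp] diagonalisesD(1)[OF Ue]
    have "log 2 (exp (- e j) / Z) = - (e j / ln 2 + log 2 Z)" for j
      using Z by (simp add: log_def ln_div diff_divide_distrib)
    then have "cross_entropy S \<sigma> = (\<Sum>i<n. \<Sum>j<n. overlap V U i j * (p i * (e j / ln 2 + log 2 Z)))"
      unfolding cross_entropy_diagonalised[OF Vp \<sigma>] by (simp only: mult_minus_right sum_negf minus_minus)
    also have "\<dots> = (\<Sum>i<n. \<Sum>j<n. overlap V U i j * (p i * e j)) / ln 2
        + (\<Sum>i<n. \<Sum>j<n. overlap V U i j * (p i * log 2 Z))"
      unfolding sum_divide_distrib sum.distrib[symmetric]
      by (intro sum.cong refl) (simp add: algebra_simps)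
    also have "\<dots> = Re (mat_trace (S * H)) / ln 2 + log 2 Z"
      unfolding trace_mult_diagonalised[OF Vp Ue] sum_overlap_mult[OF uv] Re_complex_of_real
      using state_diagonalised(2)[OF S Vp] by (simp add: sum_distrib_right[symmetric])
    finally show ?thesis .
  qed
  have "relative_entropy R \<sigma> = ereal (cross_entropy R \<sigma> - von_neumann_entropy R)"
    by (rule relative_entropy_eq_cross[OF R \<sigma>]) (use Z in simp)
  then show "relative_entropy R \<sigma> = ereal ((Re (mat_trace (R * H)) - Re (mat_trace (\<sigma> * H))) / ln 2
      + von_neumann_entropy \<sigma> - von_neumann_entropy R)"
    using cross[OF R] cross[OF st] by (simp add: von_neumann_entropy_eq_cross[of \<sigma>] diff_divide_distrib)
qed

section \<open>Short-range Hamiltonians\<close>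

lemma neighbourhood_subset: "i < m \<Longrightarrow> neighbourhood m i \<subseteq> {..<m}"
  by (auto simp: neighbourhood_def prev_site_def next_site_def)

lemma is_hermitian_add:
  assumes "A \<in> carrier_mat n n" "B \<in> carrier_mat n n" "is_hermitian A" "is_hermitian B"
  shows "is_hermitian (A + B)"
proof -
  have "A + B \<in> carrier_mat n n" using assms by simp
  then show ?thesis
  proof (subst is_hermitian_iff, assumption, intro allI impI)
    fix i j assume ij: "i < n" "j < n"
    have "A $$ (i, j) = cnj (A $$ (j, i))" "B $$ (i, j) = cnj (B $$ (j, i))"
      using assms(3,4) ij unfolding is_hermitian_iff[OF assms(1)] is_hermitian_iff[OF assms(2)]
      by blast+
    then have "A $$ (i, j) + B $$ (i, j) = cnj (A $$ (j, i) + B $$ (j, i))"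
      by (simp only: complex_cnj_add)
    then show "(A + B) $$ (i, j) = cnj ((A + B) $$ (j, i))" using assms(1,2) ij by simp
  qed
qed

lemma short_range_hamiltonian_carrier:
  "short_range_hamiltonian d m H \<Longrightarrow> H \<in> carrier_mat (sys_dim d {..<m}) (sys_dim d {..<m})"
  by (auto simp: short_range_hamiltonian_def)

lemma (in sites) short_range_hamiltonian_add:
  assumes V: "V = {..<m}"
    and H: "short_range_hamiltonian d m H" "short_range_hamiltonian d m H'"
  shows "short_range_hamiltonian d m (H + H')"
proof -
  let ?Y = "{..<m}" and ?n = "sys_dim d {..<m}"
  obtain h where h: "\<And>i. i < m \<Longrightarrow> supported_on d ?Y (neighbourhood m i) (h i)"
    "H = mat ?n ?n (\<lambda>(k, l). \<Sum>i<m. h i $$ (k, l))"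
    using H(1) unfolding short_range_hamiltonian_def by blast
  obtain h' where h': "\<And>i. i < m \<Longrightarrow> supported_on d ?Y (neighbourhood m i) (h' i)"
    "H' = mat ?n ?n (\<lambda>(k, l). \<Sum>i<m. h' i $$ (k, l))"
    using H(2) unfolding short_range_hamiltonian_def by blast
  have "supported_on d ?Y (neighbourhood m i) (h i + h' i)" if i: "i < m" for i
  proof -
    let ?k = "sys_dim d (neighbourhood m i)"
    obtain P P' where P: "P \<in> carrier_mat ?k ?k" "h i = extend_op d ?Y (neighbourhood m i) P"
      and P': "P' \<in> carrier_mat ?k ?k" "h' i = extend_op d ?Y (neighbourhood m i) P'"
      using h(1)[OF i] h'(1)[OF i] unfolding supported_on_def by blast
    have "h i + h' i = extend_op d ?Y (neighbourhood m i) (P + P')"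
      unfolding P P' using neighbourhood_subset[OF i] V
      by (intro extend_op_add[symmetric] P P' sub_index_less) simp
    then show ?thesis using P P' unfolding supported_on_def by (metis add_carrier_mat)
  qed
  moreover have "H + H' = mat ?n ?n (\<lambda>(k, l). \<Sum>i<m. (h i + h' i) $$ (k, l))"
  proof (rule eq_matI)
    fix k l assume "k < dim_row (mat ?n ?n (\<lambda>(k, l). \<Sum>i<m. (h i + h' i) $$ (k, l)))"
      "l < dim_col (mat ?n ?n (\<lambda>(k, l). \<Sum>i<m. (h i + h' i) $$ (k, l)))"
    then have kl: "k < ?n" "l < ?n" by auto
    have "dim_row (h' i) = ?n" "dim_col (h' i) = ?n" if "i < m" for i
      using h'(1)[OF that] unfolding supported_on_def by (auto simp: extend_op_def)
    then have sum: "(\<Sum>i<m. (h i + h' i) $$ (k, l)) = (\<Sum>i<m. h i $$ (k, l)) + (\<Sum>i<m. h' i $$ (k, l))"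
      using kl unfolding sum.distrib[symmetric] by (intro sum.cong refl index_add_mat(1)) auto
    show "(H + H') $$ (k, l) = mat ?n ?n (\<lambda>(k, l). \<Sum>i<m. (h i + h' i) $$ (k, l)) $$ (k, l)"
      unfolding h(2) h'(2) using kl sum by simp
  qed (simp_all add: h(2) h'(2))
  moreover have "is_hermitian (H + H')"
    using H by (intro is_hermitian_add[OF H(1,2)[THEN short_range_hamiltonian_carrier]])
      (auto simp: short_range_hamiltonian_def)
  ultimately show ?thesis
    unfolding short_range_hamiltonian_def
    by (intro conjI exI[of _ "\<lambda>i. h i + h' i"] allI impI)
qed

lemma is_hermitian_zero: "is_hermitian (0\<^sub>m n n)"
  by (subst is_hermitian_iff[of _ n]) auto

lemma supported_on_zero:
  "supported_on d Y X (0\<^sub>m (sys_dim d Y) (sys_dim d Y))" if "\<And>k. sub_index d Y X k < sys_dim d X"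
  unfolding supported_on_def
  using that by (intro bexI[of _ "0\<^sub>m (sys_dim d X) (sys_dim d X)"]) (auto simp: extend_op_def)

lemma (in sites) short_range_hamiltonian_zero:
  assumes "V = {..<m}"
  shows "short_range_hamiltonian d m (0\<^sub>m (sys_dim d {..<m}) (sys_dim d {..<m}))"
  unfolding short_range_hamiltonian_def
  using neighbourhood_subset[of _ m] assms
  by (intro conjI is_hermitian_zero exI[of _ "\<lambda>_. 0\<^sub>m (sys_dim d {..<m}) (sys_dim d {..<m})"]
      allI impI supported_on_zero sub_index_less) (auto simp: mat_eq_iff)

text \<open>Extending first from \<open>X\<close> to the neighbourhood and then to the chain shows
  that smaller supports are allowed. The other local terms are taken to be zero.\<close>

lemma (in sites) short_range_hamiltonian_extend_op:
  assumes V: "V = {..<m}" and i: "i < m" and X: "X \<subseteq> neighbourhood m i"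
    and P: "diagonalises (sys_dim d X) U e P"
  shows "short_range_hamiltonian d m (extend_op d {..<m} X P)"
proof -
  let ?Y = "{..<m}" and ?M = "neighbourhood m i" and ?n = "sys_dim d {..<m}"
  have M: "?M \<subseteq> ?Y" by (rule neighbourhood_subset[OF i])
  define Q where "Q = extend_op d ?Y X P"
  have Q: "Q \<in> carrier_mat ?n ?n" by (simp add: Q_def)
  define h where "h j = (if j = i then Q else 0\<^sub>m ?n ?n)" for j
  have "Q = extend_op d ?Y ?M (extend_op d ?M X P)"
    unfolding Q_def using M X V by (simp add: extend_op_trans)
  then have "supported_on d ?Y ?M Q" unfolding supported_on_def by auto
  then have "supported_on d ?Y (neighbourhood m j) (h j)" if "j < m" for j
    using neighbourhood_subset[OF that] V
    by (cases "j = i") (auto simp: h_def intro!: supported_on_zero sub_index_less)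
  moreover have "Q = mat ?n ?n (\<lambda>(k, l). \<Sum>j<m. h j $$ (k, l))"
  proof (rule eq_matI)
    show "Q $$ (k, l) = mat ?n ?n (\<lambda>(k, l). \<Sum>j<m. h j $$ (k, l)) $$ (k, l)"
      if "k < dim_row (mat ?n ?n (\<lambda>(k, l). \<Sum>j<m. h j $$ (k, l)))"
        "l < dim_col (mat ?n ?n (\<lambda>(k, l). \<Sum>j<m. h j $$ (k, l)))" for k l
    proof -
      have kl: "k < ?n" "l < ?n" using that by auto
      have "(\<Sum>j<m. h j $$ (k, l)) = (\<Sum>j<m. if j = i then Q $$ (k, l) else 0)"
        using kl by (intro sum.cong refl) (simp add: h_def)
      then show ?thesis using kl i by simp
    qed
  qed (use Q in auto)
  moreover have "is_hermitian Q"
    unfolding Q_def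
    by (rule diagonalises_imp_hermitian[OF extend_op_diagonalises[OF _ _ P]]) (use M X V in auto)
  ultimately show ?thesis
    unfolding short_range_hamiltonian_def Q_def by (intro conjI exI[of _ h] allI impI)
qed

section \<open>Covers by neighbourhoods\<close>

text \<open>A pair \<open>(N, B)\<close> records that the set \<open>N\<close> is added to sites already covered, which it meets
  in \<open>B\<close>. The entropy of the covered sites then grows by at most \<open>S(N) - S(B)\<close>.\<close>

inductive local_cover :: "nat \<Rightarrow> nat set \<Rightarrow> (nat set \<times> nat set) list \<Rightarrow> bool" for m where
  empty: "local_cover m {} []"
| add: "local_cover m W L \<Longrightarrow> i < m \<Longrightarrow> N \<subseteq> neighbourhood m i \<Longrightarrow> local_cover m (W \<union> N) ((N, N \<inter> W) # L)"

text \<open>With \<open>f\<close> an entropy this bounds the entropy of the covered sites; with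
  cross entropies it is the expectation of the Hamiltonian.\<close>

definition cover_sum :: "(nat set \<Rightarrow> real) \<Rightarrow> (nat set \<times> nat set) list \<Rightarrow> real" where
  "cover_sum f L = (\<Sum>(N, B)\<leftarrow>L. f N - f B)"

lemma cover_sum_simps [simp]:
  "cover_sum f [] = 0" "cover_sum f ((N, B) # L) = f N - f B + cover_sum f L"
  by (simp_all add: cover_sum_def)

lemma local_cover_subset: "local_cover m W L \<Longrightarrow> W \<subseteq> {..<m}"
  by (induction rule: local_cover.induct) (use neighbourhood_subset in blast)+

lemma local_cover_sets:
  assumes "local_cover m W L" "(N, B) \<in> set L"
  shows "B \<subseteq> N" "\<exists>i<m. N \<subseteq> neighbourhood m i"
  using assms by (induction rule: local_cover.induct) auto

lemma tendsto_cover_sum: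
  assumes "\<And>N B. (N, B) \<in> set L \<Longrightarrow> (f N \<longlongrightarrow> g N) F \<and> (f B \<longlongrightarrow> g B) F"
  shows "((\<lambda>t. cover_sum (\<lambda>X. f X t) L) \<longlongrightarrow> cover_sum g L) F"
  using assms
proof (induction L)
  case (Cons a L)
  obtain N B where a: "a = (N, B)" by fastforce
  have "((\<lambda>t. cover_sum (\<lambda>X. f X t) L) \<longlongrightarrow> cover_sum g L) F"
    by (rule Cons.IH) (use Cons.prems in auto)
  then show ?case
    using Cons.prems[of N B] unfolding a by (auto intro!: tendsto_intros)
qed simp

lemma cover_sum_mono:
  assumes "\<And>N B. (N, B) \<in> set L \<Longrightarrow> f N - f B \<le> g N - g B"
  shows "cover_sum f L \<le> cover_sum g L"
  unfolding cover_sum_def using assms by (intro sum_list_mono) auto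

section \<open>The Hamiltonian of a cover and its Gibbs state\<close>

context sites
begin

lemma entropy_le_cover_sum:
  assumes V: "V = {..<m}" and R: "state (sys_dim d {..<m}) R" and L: "local_cover m W L"
  shows "entropy d {..<m} R W \<le> cover_sum (entropy d {..<m} R) L"
  using L
proof (induction rule: local_cover.induct)
  case empty
  show ?case using entropy_empty[of "{..<m}" R] R V by simp
next
  case (add W L i N)
  have "W \<subseteq> {..<m}" "N \<subseteq> {..<m}"
    using local_cover_subset[OF add(1)] neighbourhood_subset[OF add(2)] add(3) by auto
  then have "entropy d {..<m} R (W \<union> N) + entropy d {..<m} R (W \<inter> N)
      \<le> entropy d {..<m} R W + entropy d {..<m} R N"
    using R V by (intro strong_subadditivity) auto
  then show ?case using add.IH by (simp add: Int_commute)
qed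

text \<open>The operator \<open>- \<Sum> (ln T\<^sub>N - ln T\<^sub>B)\<close>, where \<open>T\<close> is the family of marginals of a state.\<close>

fun cover_hamiltonian :: "nat set \<Rightarrow> (nat set \<Rightarrow> complex mat) \<Rightarrow> (nat set \<times> nat set) list \<Rightarrow> complex mat" where
  "cover_hamiltonian Y T [] = 0\<^sub>m (sys_dim d Y) (sys_dim d Y)"
| "cover_hamiltonian Y T ((N, B) # L) = extend_op d Y N (complex_of_real (- ln 2) \<cdot>\<^sub>m mat_log2 (T N))
     + (extend_op d Y B (complex_of_real (ln 2) \<cdot>\<^sub>m mat_log2 (T B)) + cover_hamiltonian Y T L)"

lemma trace_extend_scaled_log:
  assumes Y: "Y \<subseteq> V" and X: "X \<subseteq> Y" and R: "R \<in> carrier_mat (sys_dim d Y) (sys_dim d Y)"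
    and T: "diagonalises (sys_dim d X) U q T"
  shows "Re (mat_trace (R * extend_op d Y X (complex_of_real c \<cdot>\<^sub>m mat_log2 T)))
    = - c * cross_entropy (reduced_state d Y X R) T"
proof -
  note log = diagonalisesD(3)[OF mat_log2_diagonalises[OF T]]
  have "mat_trace (R * extend_op d Y X (complex_of_real c \<cdot>\<^sub>m mat_log2 T))
      = mat_trace (reduced_state d Y X R * (complex_of_real c \<cdot>\<^sub>m mat_log2 T))"
    by (rule trace_extend_op[OF Y X R]) (use log in simp)
  also have "\<dots> = complex_of_real c * mat_trace (reduced_state d Y X R * mat_log2 T)"
    using log by (simp add: mult_smult_distrib[OF reduced_state_carrier] mat_trace_smult[of _ "sys_dim d X"])
  finally show ?thesis by (simp add: cross_entropy_def)
qed

lemma cover_hamiltonian_short_range: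
  assumes V: "V = {..<m}"
    and L: "\<And>N B. (N, B) \<in> set L \<Longrightarrow> B \<subseteq> N \<and> (\<exists>i<m. N \<subseteq> neighbourhood m i)"
    and T: "\<And>X. X \<subseteq> {..<m} \<Longrightarrow> \<exists>U q. diagonalises (sys_dim d X) U q (T X)"
  shows "short_range_hamiltonian d m (cover_hamiltonian {..<m} T L)"
  using L
proof (induction L)
  case Nil
  show ?case using short_range_hamiltonian_zero[OF V] by simp
next
  case (Cons a L)
  obtain N B where a: "a = (N, B)" by fastforce
  obtain i where i: "i < m" "N \<subseteq> neighbourhood m i" "B \<subseteq> neighbourhood m i"
    using Cons.prems[of N B] a by auto
  have short: "short_range_hamiltonian d m (extend_op d {..<m} X (complex_of_real c \<cdot>\<^sub>m mat_log2 (T X)))"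
    if X: "X \<subseteq> neighbourhood m i" for X c
  proof -
    obtain U q where "diagonalises (sys_dim d X) U q (T X)"
      using T[OF subset_trans[OF X neighbourhood_subset[OF i(1)]]] by blast
    then show ?thesis
      using short_range_hamiltonian_extend_op[OF V i(1) X diagonalises_scaled[OF mat_log2_diagonalises]]
      by blast
  qed
  have "short_range_hamiltonian d m (cover_hamiltonian {..<m} T L)"
    by (rule Cons.IH) (use Cons.prems in auto)
  then show ?case
    unfolding a cover_hamiltonian.simps
    by (intro short_range_hamiltonian_add[OF V] short i)
qed

text \<open>The factors \<open>ln 2\<close> in the Hamiltonian turn \<open>mat_log2\<close> into the
  natural logarithm that \<open>e^-H\<close> requires; dividing by \<open>ln 2\<close> returns to
  bits.\<close>

lemma trace_cover_hamiltonian: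
  assumes V: "V = {..<m}" and R: "R \<in> carrier_mat (sys_dim d {..<m}) (sys_dim d {..<m})"
    and L: "\<And>N B. (N, B) \<in> set L \<Longrightarrow> N \<subseteq> {..<m} \<and> B \<subseteq> {..<m}"
    and T: "\<And>X. X \<subseteq> {..<m} \<Longrightarrow> \<exists>U q. diagonalises (sys_dim d X) U q (T X)"
  shows "Re (mat_trace (R * cover_hamiltonian {..<m} T L)) / ln 2
    = cover_sum (\<lambda>X. cross_entropy (reduced_state d {..<m} X R) (T X)) L"
  using L
proof (induction L)
  case Nil
  show ?case using R by (simp add: mat_trace_def)
next
  case (Cons a L)
  let ?n = "sys_dim d {..<m}"
  obtain N B where a: "a = (N, B)" by fastforce
  have NB: "N \<subseteq> {..<m}" "B \<subseteq> {..<m}" using Cons.prems[of N B] a by auto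
  obtain U q where N: "diagonalises (sys_dim d N) U q (T N)" using T[OF NB(1)] by blast
  obtain U' q' where B: "diagonalises (sys_dim d B) U' q' (T B)" using T[OF NB(2)] by blast
  have Y: "{..<m} \<subseteq> V" using V by simp
  have c: "cover_hamiltonian {..<m} T L \<in> carrier_mat ?n ?n"
    by (induction L) auto
  have "mat_trace (R * cover_hamiltonian {..<m} T (a # L))
    = mat_trace (R * extend_op d {..<m} N (complex_of_real (- ln 2) \<cdot>\<^sub>m mat_log2 (T N)))
      + (mat_trace (R * extend_op d {..<m} B (complex_of_real (ln 2) \<cdot>\<^sub>m mat_log2 (T B)))
      + mat_trace (R * cover_hamiltonian {..<m} T L))"
    unfolding a cover_hamiltonian.simps
    by (simp only: mat_trace_mult_add[OF R] extend_op_carrier add_carrier_mat[OF c] c)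
  then have "Re (mat_trace (R * cover_hamiltonian {..<m} T (a # L)))
    = ln 2 * cross_entropy (reduced_state d {..<m} N R) (T N)
      - ln 2 * cross_entropy (reduced_state d {..<m} B R) (T B)
      + Re (mat_trace (R * cover_hamiltonian {..<m} T L))"
    by (simp only: plus_complex.sel trace_extend_scaled_log[OF Y NB(1) R N]
        trace_extend_scaled_log[OF Y NB(2) R B])
  moreover have "Re (mat_trace (R * cover_hamiltonian {..<m} T L)) / ln 2
    = cover_sum (\<lambda>X. cross_entropy (reduced_state d {..<m} X R) (T X)) L"
    by (rule Cons.IH) (use Cons.prems in auto)
  ultimately show ?case unfolding a by (simp add: field_simps)
qed

text \<open>Reduces the problem to covers: only the excess of the cover sum over the entropy of
  \<rho> matters. The strict inequality leaves room for the perturbation by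
  \<open>t\<close>.\<close>

theorem short_range_approximation:
  assumes V: "V = {..<m}" and \<rho>: "state (sys_dim d {..<m}) \<rho>" and L: "local_cover m {..<m} L"
    and less: "cover_sum (entropy d {..<m} \<rho>) L - von_neumann_entropy \<rho> < c"
  shows "\<exists>H. short_range_hamiltonian d m H \<and> relative_entropy \<rho> (gibbs_state H) \<le> ereal c"
proof -
  let ?Y = "{..<m}" and ?n = "sys_dim d {..<m}"
  let ?\<rho> = "\<lambda>X. reduced_state d ?Y X \<rho>"
  define T where "T t X = depolarise (sys_dim d X) t (?\<rho> X)" for t X
  have Y: "?Y \<subseteq> V" using V by simp
  have st: "state (sys_dim d X) (?\<rho> X)" if "X \<subseteq> ?Y" for X by (rule state_reduced[OF Y that \<rho>])
  have sets: "B \<subseteq> N \<and> (\<exists>i<m. N \<subseteq> neighbourhood m i)" "N \<subseteq> ?Y \<and> B \<subseteq> ?Y" if "(N, B) \<in> set L" for N B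
    using local_cover_sets[OF L that] neighbourhood_subset by blast+
  \<comment> \<open>Only the second argument is depolarised. \<rho> itself stays fixed, so the limit
    is the cover sum of the true entropies.\<close>
  have "((\<lambda>t. cover_sum (\<lambda>X. cross_entropy (?\<rho> X) (T t X)) L - von_neumann_entropy \<rho>)
      \<longlongrightarrow> cover_sum (entropy d ?Y \<rho>) L - von_neumann_entropy \<rho>) (at_right 0)"
    by (intro tendsto_diff tendsto_const tendsto_cover_sum)
      (use sets st in \<open>auto simp: T_def entropy_def intro!: tendsto_entropy_depolarise(2)\<close>)
  from order_tendstoD(2)[OF this less]
  have "\<forall>\<^sub>F t in at_right 0. cover_sum (\<lambda>X. cross_entropy (?\<rho> X) (T t X)) L - von_neumann_entropy \<rho> < c" .
  moreover have "\<forall>\<^sub>F t in at_right 0. t \<in> {0<..<1::real}" by (rule eventually_at_right_real) simp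
  ultimately have "\<forall>\<^sub>F t in at_right 0. t \<in> {0<..<1::real} \<and>
      cover_sum (\<lambda>X. cross_entropy (?\<rho> X) (T t X)) L - von_neumann_entropy \<rho> < c"
    by eventually_elim simp
  then obtain t :: real where t: "0 < t" "t < 1"
    and tc: "cover_sum (\<lambda>X. cross_entropy (?\<rho> X) (T t X)) L - von_neumann_entropy \<rho> < c"
    using eventually_happens'[OF trivial_limit_at_right_real] by fastforce
  have pos: "\<exists>U q. diagonalises (sys_dim d X) U q (T t X) \<and> (\<forall>i<sys_dim d X. 0 < q i)"
    if "X \<subseteq> ?Y" for X
    unfolding T_def by (rule depolarise_positive[OF st[OF that]]) (use t in auto)
  then have diag: "\<exists>U q. diagonalises (sys_dim d X) U q (T t X)" if "X \<subseteq> ?Y" for X using that by blast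
  define H where "H = cover_hamiltonian ?Y (T t) L"
  have short: "short_range_hamiltonian d m H"
    unfolding H_def by (rule cover_hamiltonian_short_range[OF V sets(1) diag])
  then have Hc: "H \<in> carrier_mat ?n ?n" "is_hermitian H"
    by (auto simp: short_range_hamiltonian_def)
  define \<sigma> where "\<sigma> = gibbs_state H"
  have \<sigma>: "state ?n \<sigma>" and rel: "relative_entropy \<rho> \<sigma> = ereal ((Re (mat_trace (\<rho> * H))
      - Re (mat_trace (\<sigma> * H))) / ln 2 + von_neumann_entropy \<sigma> - von_neumann_entropy \<rho>)"
    unfolding \<sigma>_def using gibbs_state_relative_entropy[OF \<rho> Hc] by auto
  have trH: "Re (mat_trace (R * H)) / ln 2
      = cover_sum (\<lambda>X. cross_entropy (reduced_state d ?Y X R) (T t X)) L" if "state ?n R" for R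
    unfolding H_def by (rule trace_cover_hamiltonian[OF V _ sets(2) diag]) (use that in \<open>auto simp: state_def\<close>)
  \<comment> \<open>This chain of inequalities ends in Tr(\<sigma> H) / ln 2, which amounts to Z
    \<le> 1 although \<open>Z\<close> is never mentioned.\<close>
  have "von_neumann_entropy \<sigma> \<le> cover_sum (entropy d ?Y \<sigma>) L"
    using entropy_le_cover_sum[OF V \<sigma> L] reduced_state_self[OF Y, of \<sigma>] \<sigma>
    by (simp add: entropy_def state_def)
  also have "\<dots> \<le> cover_sum (\<lambda>X. cross_entropy (reduced_state d ?Y X \<sigma>) (T t X)) L"
  proof (rule cover_sum_mono)
    fix N B assume "(N, B) \<in> set L"
    then have N: "N \<subseteq> ?Y" and B: "B \<subseteq> N" "B \<subseteq> ?Y" and NV: "N \<subseteq> V" using sets Y by blast+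
    \<comment> \<open>Both families are consistent: their members on \<open>B\<close> are the
      marginals of those on \<open>N\<close>, as monotonicity from \<open>N\<close> to
      \<open>B\<close> requires.\<close>
    have red: "reduced_state d N B (T t N) = T t B" "reduced_state d N B (reduced_state d ?Y N \<sigma>) = reduced_state d ?Y B \<sigma>"
      using \<rho> \<sigma> by (simp_all add: T_def reduced_state_depolarise[OF NV B(1)] state_def
          reduced_state_trans[OF Y N B(1)])
    obtain U q U' q' where "diagonalises (sys_dim d N) U q (T t N)" "\<And>i. i < sys_dim d N \<Longrightarrow> 0 < q i"
      "diagonalises (sys_dim d B) U' q' (T t B)" "\<And>i. i < sys_dim d B \<Longrightarrow> 0 < q' i"
      using pos[OF N] pos[OF B(2)] by blast
    then show "entropy d ?Y \<sigma> N - entropy d ?Y \<sigma> B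
      \<le> cross_entropy (reduced_state d ?Y N \<sigma>) (T t N) - cross_entropy (reduced_state d ?Y B \<sigma>) (T t B)"
      using relative_entropy_reduced_le[OF NV B(1) state_reduced[OF Y N \<sigma>], of U q "T t N" U' q']
      by (simp add: red entropy_def)
  qed
  also have "\<dots> = Re (mat_trace (\<sigma> * H)) / ln 2" by (rule trH[OF \<sigma>, symmetric])
  finally have "(Re (mat_trace (\<rho> * H)) - Re (mat_trace (\<sigma> * H))) / ln 2
      + von_neumann_entropy \<sigma> - von_neumann_entropy \<rho> \<le> c"
    using tc trH[OF \<rho>] by (simp add: diff_divide_distrib)
  then have "relative_entropy \<rho> (gibbs_state H) \<le> ereal c" using rel by (simp add: \<sigma>_def)
  then show ?thesis using short by blast
qed

end

section \<open>Covers of the closed chain\<close>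

lemma local_cover_addI:
  assumes "local_cover m W L" "i < m" "N \<subseteq> neighbourhood m i" "W' = W \<union> N" "B = N \<inter> W"
  shows "local_cover m W' ((N, B) # L)"
  using local_cover.add[OF assms(1-3)] assms(4,5) by simp

lemma prev_site_inner: "0 < i \<Longrightarrow> i < m \<Longrightarrow> prev_site m i = i - 1"
proof -
  assume i: "0 < i" "i < m"
  then have "i + m - 1 = (i - 1) + m" by simp
  then show ?thesis using i by (simp only: prev_site_def mod_add_self2) simp
qed

lemma next_site_inner: "Suc i < m \<Longrightarrow> next_site m i = i + 1"
  by (simp add: next_site_def)

lemma neighbourhood_inner: "Suc i < m \<Longrightarrow> 0 < i \<Longrightarrow> neighbourhood m i = {i - 1, i, i + 1}"
  by (simp add: neighbourhood_def prev_site_inner next_site_inner)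

lemma neighbourhood_zero: "2 \<le> m \<Longrightarrow> neighbourhood m 0 = {m - 1, 0, 1}"
  by (simp add: neighbourhood_def prev_site_def next_site_def)

text \<open>With at most three sites the neighbourhood of site 0 is the whole ring.\<close>

lemma small_chain_cover:
  assumes "1 \<le> m" "m \<le> 3"
  shows "local_cover m {..<m} [({..<m}, {})]"
proof (rule local_cover_addI[OF local_cover.empty, of 0])
  have "m = 1 \<or> m = 2 \<or> m = 3" using assms by auto
  then show "{..<m} \<subseteq> neighbourhood m 0"
    by (auto simp: neighbourhood_def prev_site_def next_site_def)
qed (use assms in auto)

lemma closed_markov_chainD:
  assumes "closed_markov_chain d m \<epsilon> R" "i < m"
  shows "entropy d {..<m} R (neighbourhood m i)
    + entropy d {..<m} R ({prev_site m i, next_site m i} \<union> ({..<m} - neighbourhood m i))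
    - entropy d {..<m} R {..<m} - entropy d {..<m} R {prev_site m i, next_site m i} \<le> \<epsilon>"
proof -
  have "{i} \<union> {prev_site m i, next_site m i} = neighbourhood m i"
    "{i} \<union> {prev_site m i, next_site m i} \<union> ({..<m} - neighbourhood m i) = {..<m}"
    using neighbourhood_subset[OF assms(2)] by (auto simp: neighbourhood_def)
  then show ?thesis
    using assms unfolding closed_markov_chain_def cond_mutual_info_def by metis
qed

text \<open>Rings of at most three sites are a single neighbourhood and are treated apart.\<close>

locale closed_chain_state = sites d "{..<m}" for d m +
  fixes R :: "complex mat" and \<epsilon> :: real
  assumes R: "state (sys_dim d {..<m}) R"
    and closed: "closed_markov_chain d m \<epsilon> R"
    and four_le: "4 \<le> m"
begin

abbreviation S :: "nat set \<Rightarrow> real" where "S \<equiv> entropy d {..<m} R"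

lemma S_empty [simp]: "S {} = 0"
  by (rule entropy_empty[OF subset_refl R])

lemma ssa:
  assumes "A \<subseteq> {..<m}" "B \<subseteq> {..<m}" "A \<union> B = C" "A \<inter> B = D"
  shows "S C + S D \<le> S A + S B"
  using strong_subadditivity[OF subset_refl R assms(1,2)] assms(3,4) by simp

text \<open>Site 0 is added last, when both its neighbours are present. The overlap is then the
  conditioning set \<open>{m - 1, 1}\<close> of the closed Markov condition at 0, so the excess
  grows by at most \<epsilon>.\<close>

lemma close_cover:
  assumes L: "local_cover m {1..m - 1} L" and le: "cover_sum S L \<le> S {1..m - 1} + c"
  shows "\<exists>L. local_cover m {..<m} L \<and> cover_sum S L \<le> S {..<m} + c + \<epsilon>"
proof (intro exI conjI)
  show "local_cover m {..<m} (({m - 1, 0, 1}, {m - 1, 1}) # L)"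
    by (rule local_cover_addI[OF L, of 0]) (use four_le in \<open>auto simp: neighbourhood_zero\<close>)
  have "prev_site m 0 = m - 1" "next_site m 0 = 1"
    using four_le by (simp_all add: prev_site_def next_site_def)
  moreover have "{m - 1, 1} \<union> ({..<m} - {m - 1, 0, 1}) = {1..m - 1}" using four_le by auto
  ultimately have "S {m - 1, 0, 1} + S {1..m - 1} - S {..<m} - S {m - 1, 1} \<le> \<epsilon>"
    using closed_markov_chainD[OF closed, of 0] four_le neighbourhood_zero[of m] by simp
  then show "cover_sum S (({m - 1, 0, 1}, {m - 1, 1}) # L) \<le> S {..<m} + c + \<epsilon>" using le by simp
qed

lemma cover_one: "local_cover m {1..1} [({1}, {})]"
  by (rule local_cover_addI[OF local_cover.empty, of 1])
    (use four_le in \<open>auto simp: neighbourhood_inner\<close>)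

text \<open>A step adds two sites because the Markov condition at \<open>j + 1\<close> conditions on
  both neighbours. By the chain rule the error I({j+1, j+2} : {1..j-1} | j) is I(j+2 : {1..j-1} | j)
  + I(j+1 : {1..j-1} | {j, j+2}); each term is at most \<epsilon>.\<close>

lemma cover_of_mutual_info:
  assumes mi: "\<And>i. i < m \<Longrightarrow> mutual_info d {..<m} R {i} ({..<m} - neighbourhood m i) \<le> \<epsilon>"
    and \<epsilon>: "0 \<le> \<epsilon>"
  shows "1 \<le> k \<Longrightarrow> k < m \<Longrightarrow> \<exists>L. local_cover m {1..k} L \<and> cover_sum S L \<le> S {1..k} + real (k - 1) * \<epsilon>"
proof (induction k rule: less_induct)
  case (less k)
  consider "k = 1" | "k = 2" | j where "k = j + 2" "1 \<le> j"
    using less.prems(1) by (metis One_nat_def Suc_1 add_2_eq_Suc' le_antisym le_add_diff_inverse2 not_less_eq_eq)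
  then show ?case
  proof cases
    case 1
    then show ?thesis using cover_one by (intro exI[of _ "[({1}, {})]"]) auto
  next
    case 2
    \<comment> \<open>Steps of length two need a second start for even \<open>k\<close>. One set on
      both sites has no excess.\<close>
    have "local_cover m {1..2} [({1, 2}, {})]"
      by (rule local_cover_addI[OF local_cover.empty, of 1])
        (use four_le in \<open>auto simp: neighbourhood_inner\<close>)
    moreover have "{1..2} = {1, 2::nat}" by auto
    ultimately show ?thesis using 2 \<epsilon> by (intro exI[of _ "[({1, 2}, {})]"]) auto
  next
    case 3
    obtain L where L: "local_cover m {1..j} L" "cover_sum S L \<le> S {1..j} + real (j - 1) * \<epsilon>"
      using less.IH[of j] less.prems 3 by auto
    let ?N = "{j, j + 1, j + 2}"
    have j: "j + 2 < m" using less.prems 3 by simp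
    have N: "neighbourhood m (j + 1) = ?N" using j by (auto simp: neighbourhood_inner)
    have cover: "local_cover m {1..k} ((?N, {j}) # L)"
      by (rule local_cover_addI[OF L(1), of "j + 1"]) (use j 3 in \<open>auto simp: neighbourhood_inner\<close>)
    \<comment> \<open>The successor of \<open>j + 2\<close> may wrap around to 0, but the stretch
      starts at 1.\<close>
    have far: "{1..j} \<subseteq> {..<m} - neighbourhood m (j + 2)"
      using j 3(2) by (auto simp: neighbourhood_def prev_site_inner next_site_def mod_if)
    define F where "F = {..<m} - neighbourhood m (j + 2)"
    have F: "{1..j} \<subseteq> F" "F \<subseteq> {..<m}" "j + 2 \<notin> F"
      using far by (auto simp: F_def neighbourhood_def)
    \<comment> \<open>The mutual information of \<open>j + 2\<close> with \<open>{1..j}\<close> is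
      at most that with the larger set \<open>F\<close>, by strong subadditivity.\<close>
    have "S {j + 2} + S F - S ({j + 2} \<union> F) \<le> \<epsilon>"
      using mi[OF j] by (simp add: mutual_info_def F_def)
    moreover have "S ({j + 2} \<union> F) + S {1..j} \<le> S ({j + 2} \<union> {1..j}) + S F"
      using F j by (intro ssa) auto
    \<comment> \<open>Subadditivity turns this bound into I(j+2 : {1..j-1} | j) \<le>
      \<epsilon>.\<close>
    moreover have "S {j + 2, j} + S {} \<le> S {j + 2} + S {j}"
      using j by (intro ssa) auto
    moreover have "S ?N + S ({..<m} - {j + 1}) - S {..<m} - S {j, j + 2} \<le> \<epsilon>"
    proof -
      have "prev_site m (j + 1) = j" "next_site m (j + 1) = j + 2"
        using j 3(2) by (simp_all add: prev_site_inner next_site_inner)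
      moreover have "{j, j + 2} \<union> ({..<m} - ?N) = {..<m} - {j + 1}" using j by auto
      ultimately show ?thesis using closed_markov_chainD[OF closed, of "j + 1"] j N by simp
    qed
    \<comment> \<open>Discarding the sites outside \<open>{1..k}\<close> from the Markov condition
      at \<open>j + 1\<close> leaves I(j+1 : {1..j-1} | {j, j+2}) \<le> \<epsilon>.\<close>
    moreover have "S {..<m} + S ({j + 2} \<union> {1..j}) \<le> S {1..k} + S ({..<m} - {j + 1})"
      using j 3 by (intro ssa) auto
    ultimately have "S {1..j} + S ?N - S {j} \<le> S {1..k} + 2 * \<epsilon>"
      by (simp add: insert_commute)
    moreover have "real (k - 1) * \<epsilon> = real (j - 1) * \<epsilon> + 2 * \<epsilon>"
      using 3 by (simp add: of_nat_diff algebra_simps)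
    ultimately show ?thesis using L(2) cover by (intro exI[of _ "(?N, {j}) # L"]) auto
  qed
qed

text \<open>Adding the next site through the pair \<open>{k + 1, k + 2}\<close> costs I({1..k} : k+2
  | k+1). This is at most the same quantity with all sites beyond \<open>k + 1\<close>, which the
  open chain bounds by \<epsilon>.\<close>

lemma cover_of_open_chain:
  assumes "open_markov_chain d \<epsilon> [1..<m] (reduced_state d {..<m} {1..<m} R)"
  shows "k + 1 < m \<Longrightarrow> \<exists>L. local_cover m {1..k + 1} L \<and> cover_sum S L \<le> S {1..k + 1} + real k * \<epsilon>"
proof (induction k)
  case 0
  then show ?case using cover_one by (intro exI[of _ "[({1}, {})]"]) auto
next
  case (Suc k)
  obtain L where L: "local_cover m {1..k + 1} L" "cover_sum S L \<le> S {1..k + 1} + real k * \<epsilon>"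
    using Suc by auto
  have k: "k + 2 < m" using Suc by simp
  have ent: "entropy d {1..<m} (reduced_state d {..<m} {1..<m} R) X = S X" if "X \<subseteq> {1..<m}" for X
    unfolding entropy_def using R that by (subst reduced_state_trans) (auto simp: state_def)
  have cover: "local_cover m {1..Suc k + 1} (({k + 1, k + 2}, {k + 1}) # L)"
    by (rule local_cover_addI[OF L(1), of "k + 1"]) (use k in \<open>auto simp: neighbourhood_inner\<close>)
  \<comment> \<open>Positions in the list count from 0, so position \<open>k\<close> holds site
    \<open>k + 1\<close>.\<close>
  have ys: "set (take k [1..<m]) = {1..<k + 1}" "set (drop (Suc k) [1..<m]) = {k + 2..<m}"
    "[1..<m] ! k = k + 1" "set [1..<m] = {1..<m}" "k < length [1..<m]"
    using k by (simp_all only: take_upt drop_upt set_upt nth_upt length_upt) auto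
  have "cond_mutual_info d {1..<m} (reduced_state d {..<m} {1..<m} R) {1..<k + 1} {k + 2..<m} {k + 1} \<le> \<epsilon>"
    using assms ys unfolding open_markov_chain_def by metis
  moreover have sets: "{1..<k + 1} \<union> {k + 1} = {1..k + 1}" "{k + 1} \<union> {k + 2..<m} = {k + 1..<m}"
    "{1..k + 1} \<union> {k + 2..<m} = {1..<m}" using k by auto
  moreover have "{1..k + 1} \<subseteq> {1..<m}" "{k + 1..<m} \<subseteq> {1..<m}" "{k + 1} \<subseteq> {1..<m}" using k by auto
  ultimately have "S {1..k + 1} + S {k + 1..<m} - S {1..<m} - S {k + 1} \<le> \<epsilon>"
    by (simp only: cond_mutual_info_def sets ent subset_refl)
  \<comment> \<open>Strong subadditivity drops the sites beyond \<open>k + 2\<close>.\<close>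
  moreover have "S {1..<m} + S {k + 1, k + 2} \<le> S {1..Suc k + 1} + S {k + 1..<m}"
    using k by (intro ssa) auto
  ultimately have "S {1..k + 1} + S {k + 1, k + 2} - S {k + 1} \<le> S {1..Suc k + 1} + \<epsilon>" by simp
  then show ?case
    using L(2) cover by (intro exI[of _ "({k + 1, k + 2}, {k + 1}) # L"]) (auto simp: algebra_simps)
qed

end

theorem theorem2:
  fixes d :: "nat \<Rightarrow> nat" and m :: nat and \<epsilon> :: real and \<rho> :: "complex mat"
  assumes "m \<ge> 1"
    and "\<And>i. i < m \<Longrightarrow> d i \<ge> 1"
    and "\<epsilon> > 0"
    and "density_matrix (sys_dim d {..<m}) \<rho>"
    and "closed_markov_chain d m \<epsilon> \<rho>"
  shows "((\<forall>i<m. mutual_info d {..<m} \<rho> {i} ({..<m} - neighbourhood m i) \<le> \<epsilon>) \<longrightarrow>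
           (\<exists>H. short_range_hamiltonian d m H \<and>
                relative_entropy \<rho> (gibbs_state H) \<le> ereal (\<epsilon> * real m))) \<and>
         ((\<forall>i<m. open_markov_chain d \<epsilon> (map (\<lambda>j. (i + j) mod m) [1..<m])
                   (reduced_state d {..<m} ({..<m} - {i}) \<rho>)) \<longrightarrow>
           (\<exists>H. short_range_hamiltonian d m H \<and>
                relative_entropy \<rho> (gibbs_state H) \<le> ereal (\<epsilon> * real m)))"
    (is "(?mi \<longrightarrow> ?goal) \<and> (?open \<longrightarrow> ?goal)")
proof -
  interpret sites d "{..<m}"
    by unfold_locales (use assms(2) in \<open>auto simp: Suc_le_eq\<close>)
  have \<rho>: "state (sys_dim d {..<m}) \<rho>" by (rule density_matrix_state[OF assms(4)])
  let ?S = "entropy d {..<m} \<rho>"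
  have S: "von_neumann_entropy \<rho> = ?S {..<m}"
    using \<rho> by (simp add: entropy_def reduced_state_self state_def)
  have goal: ?goal if "local_cover m {..<m} L" "cover_sum ?S L < ?S {..<m} + \<epsilon> * real m" for L
    using short_range_approximation[OF refl \<rho> that(1)] that(2) by (simp add: S)
  show ?thesis
  proof (cases "m \<le> 3")
    case True
    \<comment> \<open>The single set has empty overlap, so its excess is exactly 0 and the whole of
      \<open>\<epsilon> * real m\<close> is slack.\<close>
    have "0 < \<epsilon> * real m" using assms(1,3) by simp
    then have ?goal
      using goal[OF small_chain_cover[OF assms(1) True]] entropy_empty[OF subset_refl \<rho>] by simp
    then show ?thesis by blast
  next
    case False
    interpret closed_chain_state d m \<rho> \<epsilon>
      by unfold_locales (use \<rho> assms(5) False in auto)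
    \<comment> \<open>At most \<open>m - 2\<close> for the sites up to \<open>m - 1\<close> and one
      for the closing step: together \<open>m - 1\<close> times \<epsilon>, strictly below the
      target.\<close>
    have less: "?S {..<m} + real (m - 2) * \<epsilon> + \<epsilon> < ?S {..<m} + \<epsilon> * real m"
      using False assms(3) by (simp add: of_nat_diff algebra_simps)
    have closing: ?goal
      if "\<exists>L. local_cover m {1..m - 1} L \<and> cover_sum ?S L \<le> ?S {1..m - 1} + real (m - 2) * \<epsilon>"
      using close_cover less goal that by (meson le_less_trans)
    have ?goal if ?mi
    proof (rule closing)
      have "m - 1 - 1 = m - 2" by simp
      then show "\<exists>L. local_cover m {1..m - 1} L \<and> cover_sum ?S L \<le> ?S {1..m - 1} + real (m - 2) * \<epsilon>"
        using cover_of_mutual_info[of "m - 1"] that assms(3) False by auto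
    qed
    moreover have ?goal if ?open
    proof (rule closing)
      \<comment> \<open>Cutting the ring at site 0 leaves the plain list \<open>[1..<m]\<close>, the
        stretch along which the cover is built.\<close>
      have "map (\<lambda>j. (0 + j) mod m) [1..<m] = [1..<m]" by (rule map_idI) auto
      moreover have "{..<m} - {0} = {1..<m}" by auto
      ultimately have "open_markov_chain d \<epsilon> [1..<m] (reduced_state d {..<m} {1..<m} \<rho>)"
        using that assms(1) by (metis One_nat_def Suc_le_eq)
      from cover_of_open_chain[OF this, of "m - 2"]
      show "\<exists>L. local_cover m {1..m - 1} L \<and> cover_sum ?S L \<le> ?S {1..m - 1} + real (m - 2) * \<epsilon>"
        using False by (simp add: Suc_diff_Suc numeral_2_eq_2)
    qed
    ultimately show ?thesis by blast
  qed
qed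

end
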